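(* Let $W$ be a graphon, $\beta\in\mathbb R$, $C_B>0$, $P:\mathcal A\times\mathcal A\to\mathbb R$, and $\theta\in\mathcal A^\infty$. Consider the utility functional $U(\tilde a,\tilde z,\tilde\theta)=\langle\tilde a,\tilde\theta+\beta\tilde z\rangle_{\mathcal A}-\frac12\|\tilde a\|_{\mathcal A}^2+P(\tilde z,\tilde\theta)$ and let $\bar\theta$ be the optimal intervention, i.e. the solution of $$\max_{\hat\theta\in\mathcal A^\infty}\int_0^1U(\bar a^x,\bar z^x,\theta^x+\hat\theta^x)dx\quad\text{s.t. }\bar a=(\boldsymbol I-\beta\boldsymbol W)^{-1}(\theta+\hat\theta),\ \bar z=\boldsymbol W\bar a\ (\mathbb P\otimes dt\otimes d\nu\text{-a.e.}),\ \|\hat\theta\|_{\mathcal A^\infty}^2\le C_B.$$ Assume: (B1) $\beta\lambda_1(\boldsymbol W)<1$. (B2) There exists $\tilde w\in\mathbb R$ such that for every $\vartheta\in\mathcal A^\infty$, with $\bar a=(\boldsymbol I-\beta\boldsymbol W)^{-1}\vartheta$, one has $\int_0^1P\big((\boldsymbol W\bar a)(x),\vartheta^x\big)dx=\tilde w\|\bar a\|_{\mathcal A^\infty}^2$; and either $\tilde w<-\frac12$ and $\|\theta\|_{\mathcal A^\infty}^2>C_B$, or $\tilde w>-\frac12$. Furthermore $\underline\theta(\lambda)_j\ne0$, $\mathbb P\otimes dt$-a.e., for all $j=1,\dots,m(\lambda)$ and all $\lambda\in\sigma(\boldsymbol W)$. Define the similarity ratio $\bar r_\lambda:=\rho(\bar\theta,e_{\lambda,j})/\rho(\theta,e_{\lambda,j})$.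 If the game is one of strategic complements ($\beta>0$), then $|\bar r_\lambda|$ is increasing in $\lambda$, $\mathbb P\otimes dt$-a.e.; if the game is one of strategic substitutes ($\beta<0$), then $|\bar r_\lambda|$ is decreasing in $\lambda$, $\mathbb P\otimes dt$-a.e.
   Context: Probabilistic setting. Fix $T>0$, a probability space $(\Omega,\mathcal F,\mathbb P)$, a probability space $([0,1],\mathcal I,\nu)$ extending the Lebesgue space on $[0,1]$, and a rich Fubini extension $([0,1]\times\Omega,\mathcal I\boxtimes\mathcal F,\nu\boxtimes\mathbb P)$ of the product space (an extension on which Fubini's theorem holds for all integrable functions and which supports essentially pairwise independent families of processes). Write $dx$ for $\nu(dx)$. $\mathbb F=(\mathcal F_t)_{0\le t\le T}$ is the augmentation of the filtration generated by $(\theta^x)_{x\in[0,1]}$. $\mathcal A$ is the Hilbert space of $\mathbb F$-progressively measurable $\tilde a:\Omega\times[0,T]\to\mathbb R$ with $\|\tilde a\|_{\mathcal A}^2=\int_0^T\mathbb E[\tilde a_t^2]dt<\infty$, $\langle\tilde a,\tilde b\rangle_{\mathcal A}=\mathbb E[\int_0^T\tilde a_t\tilde b_tdt]$. $\mathcal A^\infty$ is the Hilbert space of families $a=(a^x)_{x\in[0,1]}$, $a^x\in\mathcal A$, with $(x,t,\omega)\mapsto a^x_t(\omega)$ being $\mathcal I\otimes\mathcal B([0,T])\otimes\mathcal F$-measurable and $\|a\|_{\mathcal A^\infty}^2=\int_0^1\int_0^T\mathbb E[(a_t^x)^2]dtdx<\infty$. A graphon is a symmetric measurable $W:[0,1]^2\to[0,1]$;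 $(\boldsymbol Wf)(x)=\int_0^1W(x,y)f(y)dy$ is the induced self-adjoint compact operator on $L^2([0,1],\mathbb R)$, applied to $\mathcal A^\infty$ pointwise in $(t,\omega)$; $\boldsymbol I$ is the identity; $\lambda_1(\boldsymbol W)$ is the largest eigenvalue. Spectral notation: $\sigma(\boldsymbol W)=\{0\}\cup\{\lambda_i\}_{i\in I}$ is the spectrum, $I$ countable; $m(\lambda)$ is the multiplicity of $\lambda$ (finite for $\lambda\ne0$, possibly $m(0)=\infty$); $\{e_{\lambda,j}\}_{j=1}^{m(\lambda)}$, $\lambda\in\sigma(\boldsymbol W)$, is an orthonormal basis of $L^2([0,1],\mathbb R)$ of eigenfunctions. $\underline f(\lambda)_j=\langle f,e_{\lambda,j}\rangle_{L^2}$, applied to elements of $\mathcal A^\infty$ pointwise in $(t,\omega)$. Cosine similarity: $\rho(f,g)=\langle f,g\rangle_{L^2}/(\|f\|_{L^2}\|g\|_{L^2})$, applied pointwise in $(t,\omega)$. The ratio $\bar r_\lambda$ does not depend on $j\in\{1,\dots,m(\lambda)\}$ ($\mathbb P\otimes dt$-a.e.), and $\lambda$ ranges over the eigenvalues in $\sigma(\boldsymbol W)$.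
   Formalization: For strategic substitutes (β<0), where (B1) holds automatically and the claim can fail, it is additionally assumed that βλ<1 for every λ in the spectrum of W; nothing is added for β>0. *)

theory Defs
  imports "HOL-Probability.Probability" "HOL-Library.Extended_Nat"
begin

section \<open>Index space, rich Fubini extension\<close>

abbreviation Leb01 :: "real measure" where
  "Leb01 \<equiv> lebesgue_on {0..1}"

abbreviation time_measure :: "real \<Rightarrow> real measure" where
  "time_measure T \<equiv> restrict_space lborel {0..T}"

definition extends_Lebesgue :: "real measure \<Rightarrow> bool" where
  "extends_Lebesgue \<nu> \<longleftrightarrow>
     prob_space \<nu> \<and> space \<nu> = {0..1} \<and> sets Leb01 \<subseteq> sets \<nu> \<and>
     (\<forall>A\<in>sets Leb01. emeasure \<nu> A = emeasure Leb01 A)"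

text \<open>
  The inner integrals in Fubini's theorem are only defined almost everywhere, hence the
  integrable functions \<open>G\<close> and \<open>H\<close> that agree with them almost everywhere.
\<close>
definition Fubini_extension ::
  "real measure \<Rightarrow> 'w measure \<Rightarrow> (real \<times> 'w) measure \<Rightarrow> bool" where
  "Fubini_extension \<nu> M Q \<longleftrightarrow>
     prob_space Q \<and> space Q = space \<nu> \<times> space M \<and>
     sets (\<nu> \<Otimes>\<^sub>M M) \<subseteq> sets Q \<and>
     (\<forall>A\<in>sets (\<nu> \<Otimes>\<^sub>M M). emeasure Q A = emeasure (\<nu> \<Otimes>\<^sub>M M) A) \<and>
     (\<forall>g::real \<times> 'w \<Rightarrow> real. integrable Q g \<longrightarrow>
        (\<exists>G. has_bochner_integral \<nu> G (integral\<^sup>L Q g) \<and>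
             (AE x in \<nu>. has_bochner_integral M (\<lambda>\<omega>. g (x, \<omega>)) (G x))) \<and>
        (\<exists>H. has_bochner_integral M H (integral\<^sup>L Q g) \<and>
             (AE \<omega> in M. has_bochner_integral \<nu> (\<lambda>x. g (x, \<omega>)) (H \<omega>))))"

text \<open>
  Richness in the sense of Sun: the extension carries a measurable, essentially pairwise
  independent family of uniformly distributed variables. Families with values in any other
  Polish space, and with any measurable prescription of the marginal laws, are images of
  such a family.
\<close>
definition rich_Fubini_extension ::
  "real measure \<Rightarrow> 'w measure \<Rightarrow> (real \<times> 'w) measure \<Rightarrow> bool" where
  "rich_Fubini_extension \<nu> M Q \<longleftrightarrow>
     Fubini_extension \<nu> M Q \<and>
     (\<exists>f::real \<times> 'w \<Rightarrow> real. f \<in> borel_measurable Q \<and>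
        (AE x in \<nu>. distr M borel (\<lambda>\<omega>. f (x, \<omega>)) = uniform_measure lborel {0..1}) \<and>
        (AE x in \<nu>. AE y in \<nu>.
           prob_space.indep_var M borel (\<lambda>\<omega>. f (x, \<omega>)) borel (\<lambda>\<omega>. f (y, \<omega>))))"

section \<open>Processes\<close>

text \<open>
  A process is a function of time and outcome. The Hilbert spaces below are represented by
  their square-integrable functions; equality in them is equality almost everywhere and is
  always written out with \<open>AE\<close>.
\<close>
type_synonym 'w process = "real \<Rightarrow> 'w \<Rightarrow> real"

definition augmented_filtration ::
  "'w measure \<Rightarrow> (real \<Rightarrow> 'w process) \<Rightarrow> real \<Rightarrow> 'w measure" where
  "augmented_filtration M \<theta> t =
     sigma (space M)
       ({\<theta> x s -` B \<inter> space M | x s B. x \<in> {0..1} \<and> s \<in> {0..t} \<and> B \<in> sets borel}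
        \<union> null_sets M)"

definition progressively_measurable ::
  "(real \<Rightarrow> 'w measure) \<Rightarrow> real \<Rightarrow> 'w process \<Rightarrow> bool" where
  "progressively_measurable F T a \<longleftrightarrow>
     (\<forall>t\<in>{0..T}. (\<lambda>(s, \<omega>). a s \<omega>) \<in> borel_measurable (restrict_space borel {0..t} \<Otimes>\<^sub>M F t))"

definition A_space ::
  "'w measure \<Rightarrow> (real \<Rightarrow> 'w measure) \<Rightarrow> real \<Rightarrow> 'w process set" where
  "A_space M F T = {a. progressively_measurable F T a \<and>
     (\<integral>\<^sup>+t. (\<integral>\<^sup>+\<omega>. ennreal ((a t \<omega>)\<^sup>2) \<partial>M) \<partial>time_measure T) < \<infinity>}"

definition A_inner :: "'w measure \<Rightarrow> real \<Rightarrow> 'w process \<Rightarrow> 'w process \<Rightarrow> real" where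
  "A_inner M T a b = (\<integral>\<omega>. (\<integral>t. a t \<omega> * b t \<omega> \<partial>time_measure T) \<partial>M)"

definition A_norm_sq :: "'w measure \<Rightarrow> real \<Rightarrow> 'w process \<Rightarrow> real" where
  "A_norm_sq M T a = (\<integral>t. (\<integral>\<omega>. (a t \<omega>)\<^sup>2 \<partial>M) \<partial>time_measure T)"

definition Ainf_space ::
  "real measure \<Rightarrow> 'w measure \<Rightarrow> (real \<Rightarrow> 'w measure) \<Rightarrow> real \<Rightarrow> (real \<Rightarrow> 'w process) set" where
  "Ainf_space \<nu> M F T = {a. (\<forall>x\<in>{0..1}. a x \<in> A_space M F T) \<and>
     (\<lambda>(x, t, \<omega>). a x t \<omega>) \<in> borel_measurable (\<nu> \<Otimes>\<^sub>M restrict_space borel {0..T} \<Otimes>\<^sub>M M) \<and>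
     (\<integral>\<^sup>+x. (\<integral>\<^sup>+t. (\<integral>\<^sup>+\<omega>. ennreal ((a x t \<omega>)\<^sup>2) \<partial>M) \<partial>time_measure T) \<partial>\<nu>) < \<infinity>}"

definition Ainf_norm_sq ::
  "real measure \<Rightarrow> 'w measure \<Rightarrow> real \<Rightarrow> (real \<Rightarrow> 'w process) \<Rightarrow> real" where
  "Ainf_norm_sq \<nu> M T a =
     (\<integral>x. (\<integral>t. (\<integral>\<omega>. (a x t \<omega>)\<^sup>2 \<partial>M) \<partial>time_measure T) \<partial>\<nu>)"

definition Ainf_eq ::
  "real measure \<Rightarrow> 'w measure \<Rightarrow> real \<Rightarrow> (real \<Rightarrow> 'w process) \<Rightarrow> (real \<Rightarrow> 'w process) \<Rightarrow> bool" where
  "Ainf_eq \<nu> M T a b \<longleftrightarrow>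
     (AE (x, t, \<omega>) in \<nu> \<Otimes>\<^sub>M time_measure T \<Otimes>\<^sub>M M. a x t \<omega> = b x t \<omega>)"

section \<open>Graphons and their spectral data\<close>

definition graphon :: "(real \<Rightarrow> real \<Rightarrow> real) \<Rightarrow> bool" where
  "graphon W \<longleftrightarrow>
     (\<lambda>(x, y). W x y) \<in> borel_measurable (Leb01 \<Otimes>\<^sub>M Leb01) \<and>
     (\<forall>x\<in>{0..1}. \<forall>y\<in>{0..1}. W x y = W y x \<and> 0 \<le> W x y \<and> W x y \<le> 1)"

definition graphon_op ::
  "real measure \<Rightarrow> (real \<Rightarrow> real \<Rightarrow> real) \<Rightarrow> (real \<Rightarrow> real) \<Rightarrow> real \<Rightarrow> real" where
  "graphon_op \<mu> W f x = (\<integral>y. W x y * f y \<partial>\<mu>)"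

definition graphon_op_process ::
  "real measure \<Rightarrow> (real \<Rightarrow> real \<Rightarrow> real) \<Rightarrow> (real \<Rightarrow> 'w process) \<Rightarrow> real \<Rightarrow> 'w process" where
  "graphon_op_process \<nu> W a x t \<omega> = graphon_op \<nu> W (\<lambda>y. a y t \<omega>) x"

definition L2 :: "real measure \<Rightarrow> (real \<Rightarrow> real) set" where
  "L2 \<mu> = {f \<in> borel_measurable \<mu>. integrable \<mu> (\<lambda>x. (f x)\<^sup>2)}"

definition L2_inner :: "real measure \<Rightarrow> (real \<Rightarrow> real) \<Rightarrow> (real \<Rightarrow> real) \<Rightarrow> real" where
  "L2_inner \<mu> f g = (\<integral>x. f x * g x \<partial>\<mu>)"

definition L2_norm :: "real measure \<Rightarrow> (real \<Rightarrow> real) \<Rightarrow> real" where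
  "L2_norm \<mu> f = sqrt (L2_inner \<mu> f f)"

definition cosine_similarity :: "real measure \<Rightarrow> (real \<Rightarrow> real) \<Rightarrow> (real \<Rightarrow> real) \<Rightarrow> real" where
  "cosine_similarity \<mu> f g = L2_inner \<mu> f g / (L2_norm \<mu> f * L2_norm \<mu> g)"

text \<open>
  The spectral data of the operator refer to \<open>L\<^sup>2([0,1])\<close> over Lebesgue measure, which is
  separable, so that a countable orthonormal basis exists; \<open>L\<^sup>2(\<nu>)\<close> is not separable when
  the Fubini extension is rich. The spectrum of a self-adjoint operator is real, and a
  bounded operator on a Hilbert space is invertible iff it is bijective.
\<close>
definition graphon_spectrum :: "(real \<Rightarrow> real \<Rightarrow> real) \<Rightarrow> real set" where
  "graphon_spectrum W = {\<kappa>. \<not> (\<forall>g\<in>L2 Leb01.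
     (\<exists>f\<in>L2 Leb01. AE x in Leb01. graphon_op Leb01 W f x - \<kappa> * f x = g x) \<and>
     (\<forall>f\<in>L2 Leb01. \<forall>h\<in>L2 Leb01.
        (AE x in Leb01. graphon_op Leb01 W f x - \<kappa> * f x = g x) \<longrightarrow>
        (AE x in Leb01. graphon_op Leb01 W h x - \<kappa> * h x = g x) \<longrightarrow>
        (AE x in Leb01. f x = h x)))}"

definition eigenspace :: "(real \<Rightarrow> real \<Rightarrow> real) \<Rightarrow> real \<Rightarrow> (real \<Rightarrow> real) set" where
  "eigenspace W \<kappa> = {f \<in> L2 Leb01. AE x in Leb01. graphon_op Leb01 W f x = \<kappa> * f x}"

definition eigenvalues :: "(real \<Rightarrow> real \<Rightarrow> real) \<Rightarrow> real set" where
  "eigenvalues W = {\<kappa>. \<exists>f\<in>eigenspace W \<kappa>. \<not> (AE x in Leb01. f x = 0)}"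

text \<open>The supremum is attained: the operator is compact, self-adjoint, with kernel \<open>W \<ge> 0\<close>.\<close>
definition largest_eigenvalue :: "(real \<Rightarrow> real \<Rightarrow> real) \<Rightarrow> real" where
  "largest_eigenvalue W = Sup (eigenvalues W)"

text \<open>
  The dimension of the eigenspace modulo null functions, as the supremum of the sizes of
  linearly independent families; it is 0 when \<open>\<kappa>\<close> is not an eigenvalue.
\<close>
definition eigen_multiplicity :: "(real \<Rightarrow> real \<Rightarrow> real) \<Rightarrow> real \<Rightarrow> enat" where
  "eigen_multiplicity W \<kappa> = Sup {enat n | n. \<exists>f. (\<forall>i<n. f i \<in> eigenspace W \<kappa>) \<and>
     (\<forall>c. (AE x in Leb01. (\<Sum>i<n. c i * f i x) = 0) \<longrightarrow> (\<forall>i<n. c i = 0))}"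

definition spectral_index :: "(real \<Rightarrow> real \<Rightarrow> real) \<Rightarrow> (real \<times> nat) set" where
  "spectral_index W =
     {(\<kappa>, j). \<kappa> \<in> graphon_spectrum W \<and> 1 \<le> j \<and> enat j \<le> eigen_multiplicity W \<kappa>}"

definition orthonormal_eigenbasis ::
  "(real \<Rightarrow> real \<Rightarrow> real) \<Rightarrow> (real \<Rightarrow> nat \<Rightarrow> real \<Rightarrow> real) \<Rightarrow> bool" where
  "orthonormal_eigenbasis W e \<longleftrightarrow>
     (\<forall>(\<kappa>, j)\<in>spectral_index W. e \<kappa> j \<in> eigenspace W \<kappa>) \<and>
     (\<forall>(\<kappa>, j)\<in>spectral_index W. \<forall>(\<kappa>', j')\<in>spectral_index W.
        L2_inner Leb01 (e \<kappa> j) (e \<kappa>' j') = (if (\<kappa>, j) = (\<kappa>', j') then 1 else 0)) \<and>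
     (\<forall>f\<in>L2 Leb01. \<forall>\<epsilon>>0. \<exists>S c. finite S \<and> S \<subseteq> spectral_index W \<and>
        L2_norm Leb01 (\<lambda>x. f x - (\<Sum>(\<kappa>, j)\<in>S. c (\<kappa>, j) * e \<kappa> j x)) < \<epsilon>)"

text \<open>Pointwise in time and outcome; \<open>x \<mapsto> a x t \<omega>\<close> is a function on the space of \<open>\<nu>\<close>.\<close>
definition spectral_coeff ::
  "real measure \<Rightarrow> (real \<Rightarrow> nat \<Rightarrow> real \<Rightarrow> real) \<Rightarrow> (real \<Rightarrow> 'w process) \<Rightarrow>
   real \<Rightarrow> nat \<Rightarrow> 'w process" where
  "spectral_coeff \<nu> e a \<kappa> j t \<omega> = L2_inner \<nu> (\<lambda>x. a x t \<omega>) (e \<kappa> j)"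

definition similarity_ratio ::
  "real measure \<Rightarrow> (real \<Rightarrow> nat \<Rightarrow> real \<Rightarrow> real) \<Rightarrow> (real \<Rightarrow> 'w process) \<Rightarrow>
   (real \<Rightarrow> 'w process) \<Rightarrow> real \<Rightarrow> nat \<Rightarrow> 'w process" where
  "similarity_ratio \<nu> e \<theta>bar \<theta> \<kappa> j t \<omega> =
     cosine_similarity \<nu> (\<lambda>x. \<theta>bar x t \<omega>) (e \<kappa> j) / cosine_similarity \<nu> (\<lambda>x. \<theta> x t \<omega>) (e \<kappa> j)"

section \<open>The intervention problem\<close>

definition utility ::
  "'w measure \<Rightarrow> real \<Rightarrow> real \<Rightarrow> ('w process \<Rightarrow> 'w process \<Rightarrow> real) \<Rightarrow>
   'w process \<Rightarrow> 'w process \<Rightarrow> 'w process \<Rightarrow> real" where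
  "utility M T \<beta> P a z \<eta> =
     A_inner M T a (\<lambda>t \<omega>. \<eta> t \<omega> + \<beta> * z t \<omega>) - 1/2 * A_norm_sq M T a + P z \<eta>"

text \<open>
  \<open>a = (I - \<beta> W)\<^sup>-\<^sup>1 \<eta>\<close> and \<open>z = W a\<close>, as identities in the Hilbert space of families:
  \<open>z\<close> is a representative of \<open>W a\<close> all of whose members are progressively measurable.
\<close>
definition equilibrium ::
  "real measure \<Rightarrow> 'w measure \<Rightarrow> (real \<Rightarrow> 'w measure) \<Rightarrow> real \<Rightarrow> real \<Rightarrow> (real \<Rightarrow> real \<Rightarrow> real) \<Rightarrow>
   (real \<Rightarrow> 'w process) \<Rightarrow> (real \<Rightarrow> 'w process) \<Rightarrow> (real \<Rightarrow> 'w process) \<Rightarrow> bool" where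
  "equilibrium \<nu> M F T \<beta> W \<eta> a z \<longleftrightarrow>
     a \<in> Ainf_space \<nu> M F T \<and> z \<in> Ainf_space \<nu> M F T \<and>
     Ainf_eq \<nu> M T (\<lambda>x t \<omega>. a x t \<omega> - \<beta> * graphon_op_process \<nu> W a x t \<omega>) \<eta> \<and>
     Ainf_eq \<nu> M T z (graphon_op_process \<nu> W a)"

definition feasible ::
  "real measure \<Rightarrow> 'w measure \<Rightarrow> (real \<Rightarrow> 'w measure) \<Rightarrow> real \<Rightarrow> real \<Rightarrow> (real \<Rightarrow> real \<Rightarrow> real) \<Rightarrow>
   real \<Rightarrow> (real \<Rightarrow> 'w process) \<Rightarrow>
   (real \<Rightarrow> 'w process) \<Rightarrow> (real \<Rightarrow> 'w process) \<Rightarrow> (real \<Rightarrow> 'w process) \<Rightarrow> bool" where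
  "feasible \<nu> M F T \<beta> W C \<theta> \<theta>hat a z \<longleftrightarrow>
     \<theta>hat \<in> Ainf_space \<nu> M F T \<and>
     equilibrium \<nu> M F T \<beta> W (\<lambda>x t \<omega>. \<theta> x t \<omega> + \<theta>hat x t \<omega>) a z \<and>
     Ainf_norm_sq \<nu> M T \<theta>hat \<le> C"

definition welfare ::
  "real measure \<Rightarrow> 'w measure \<Rightarrow> real \<Rightarrow> real \<Rightarrow> ('w process \<Rightarrow> 'w process \<Rightarrow> real) \<Rightarrow>
   (real \<Rightarrow> 'w process) \<Rightarrow>
   (real \<Rightarrow> 'w process) \<Rightarrow> (real \<Rightarrow> 'w process) \<Rightarrow> (real \<Rightarrow> 'w process) \<Rightarrow> real" where
  "welfare \<nu> M T \<beta> P \<theta> \<theta>hat a z =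
     (\<integral>x. utility M T \<beta> P (a x) (z x) (\<lambda>t \<omega>. \<theta> x t \<omega> + \<theta>hat x t \<omega>) \<partial>\<nu>)"

definition optimal_intervention ::
  "real measure \<Rightarrow> 'w measure \<Rightarrow> (real \<Rightarrow> 'w measure) \<Rightarrow> real \<Rightarrow> real \<Rightarrow> (real \<Rightarrow> real \<Rightarrow> real) \<Rightarrow>
   real \<Rightarrow> ('w process \<Rightarrow> 'w process \<Rightarrow> real) \<Rightarrow>
   (real \<Rightarrow> 'w process) \<Rightarrow> (real \<Rightarrow> 'w process) \<Rightarrow> bool" where
  "optimal_intervention \<nu> M F T \<beta> W C P \<theta> \<theta>bar \<longleftrightarrow>
     (\<exists>abar zbar. feasible \<nu> M F T \<beta> W C \<theta> \<theta>bar abar zbar \<and>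
        (\<forall>\<theta>hat a z. feasible \<nu> M F T \<beta> W C \<theta> \<theta>hat a z \<longrightarrow>
           welfare \<nu> M T \<beta> P \<theta> \<theta>hat a z \<le> welfare \<nu> M T \<beta> P \<theta> \<theta>bar abar zbar))"

text \<open>
  \<open>P\<close> is evaluated on representatives. If it is a function on the Hilbert space, the choice
  of representatives does not matter. \<open>has_bochner_integral\<close> includes the existence of the
  integral.
\<close>
definition external_effect_condition ::
  "real measure \<Rightarrow> 'w measure \<Rightarrow> (real \<Rightarrow> 'w measure) \<Rightarrow> real \<Rightarrow> real \<Rightarrow> (real \<Rightarrow> real \<Rightarrow> real) \<Rightarrow>
   ('w process \<Rightarrow> 'w process \<Rightarrow> real) \<Rightarrow> real \<Rightarrow> bool" where
  "external_effect_condition \<nu> M F T \<beta> W P w \<longleftrightarrow>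
     (\<forall>\<eta>\<in>Ainf_space \<nu> M F T. \<forall>a z. equilibrium \<nu> M F T \<beta> W \<eta> a z \<longrightarrow>
        has_bochner_integral \<nu> (\<lambda>x. P (z x) (\<eta> x)) (w * Ainf_norm_sq \<nu> M T a))"

end

(*
  At an equilibrium the utility of x is half the squared norm of its action plus the external effect,
  so by (B2) the planner maximises k |a|^2 with k = w + 1/2, a diagonal quadratic form in the spectral
  coordinates, over a ball. Stationarity gives one multiplier m >= 0 with
    k (theta_i + thetabar_i) = m (1 - beta kappa)^2 thetabar_i
  for every eigenpair i = (kappa, j), so that the ratios thetabar_i / theta_i are
  k / (m (1 - beta kappa)^2 - k). Comparing thetabar with its reflections gives positive denominators,
  and m > 0 because the budget does not suffice to cancel theta when k < 0. Hence the absolute value of the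
  ratio increases with beta kappa, while the norms in the cosine similarities only contribute a factor that is
  common to all kappa.
*)
theory Submission
  imports Defs
begin

section \<open>Square-integrable functions\<close>

text \<open>Two obstacles shape the argument. First, \<nu> may be far larger than Lebesgue measure,
  while the eigenbasis spans \<open>L2 Leb01\<close> only. A family therefore need not be determined
  by its coefficients, and \<open>I - \<beta> W\<close> cannot be inverted by expanding a family in
  the basis. What can be expanded are the sections \<open>W x\<close>, which are Lebesgue
  measurable; hence whatever is orthogonal to the basis is annihilated by the operator. Second, a
  coefficient of a family is an integral over \<open>x\<close> and need not be progressively
  measurable, so it is not an admissible amplitude for a perturbation. The perturbations used are
  products of an eigenfunction with a progressively measurable amplitude, usually a member of a
  family already at hand. Their equilibria are explicit, and by Fubini the members of a family
  suffice to detect whether its coefficient vanishes.\<close>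

definition square_integrable :: "'a measure \<Rightarrow> ('a \<Rightarrow> real) \<Rightarrow> bool" where
  "square_integrable \<mu> f \<longleftrightarrow> f \<in> borel_measurable \<mu> \<and> integrable \<mu> (\<lambda>x. (f x)\<^sup>2)"

lemma square_integrable_measurable [measurable_dest]:
  "square_integrable \<mu> f \<Longrightarrow> f \<in> borel_measurable \<mu>"
  by (simp add: square_integrable_def)

lemma square_integrable_power2: "square_integrable \<mu> f \<Longrightarrow> integrable \<mu> (\<lambda>x. (f x)\<^sup>2)"
  by (simp add: square_integrable_def)

lemma square_integrable_mult:
  assumes f: "square_integrable \<mu> f" and g: "square_integrable \<mu> g"
  shows "integrable \<mu> (\<lambda>x. f x * g x)"
proof (rule Bochner_Integration.integrable_bound)
  show "integrable \<mu> (\<lambda>x. (f x)\<^sup>2 + (g x)\<^sup>2)"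
    using f g by (simp add: square_integrable_def)
  show "(\<lambda>x. f x * g x) \<in> borel_measurable \<mu>"
    using f g by measurable
  show "AE x in \<mu>. norm (f x * g x) \<le> norm ((f x)\<^sup>2 + (g x)\<^sup>2)"
  proof (rule AE_I2)
    fix x
    have "2 * \<bar>f x\<bar> * \<bar>g x\<bar> \<le> \<bar>f x\<bar>\<^sup>2 + \<bar>g x\<bar>\<^sup>2"
      using sum_squares_bound[of "\<bar>f x\<bar>" "\<bar>g x\<bar>"] .
    moreover have "0 \<le> \<bar>f x\<bar> * \<bar>g x\<bar>" by simp
    ultimately have "\<bar>f x\<bar> * \<bar>g x\<bar> \<le> (f x)\<^sup>2 + (g x)\<^sup>2"
      unfolding mult.assoc power2_abs by linarith
    then show "norm (f x * g x) \<le> norm ((f x)\<^sup>2 + (g x)\<^sup>2)"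
      by (simp add: abs_mult)
  qed
qed

lemma square_integrable_integrable:
  assumes "finite_measure \<mu>" "square_integrable \<mu> f"
  shows "integrable \<mu> f"
proof -
  interpret finite_measure \<mu> by fact
  have "square_integrable \<mu> (\<lambda>_. 1)" by (simp add: square_integrable_def)
  from square_integrable_mult[OF assms(2) this] show ?thesis by simp
qed

lemma square_integrable_add_scaled:
  assumes f: "square_integrable \<mu> f" and g: "square_integrable \<mu> g"
  shows "square_integrable \<mu> (\<lambda>x. f x + c * g x)"
proof -
  have eq: "(f x + c * g x)\<^sup>2 = (f x)\<^sup>2 + 2 * c * (f x * g x) + c\<^sup>2 * (g x)\<^sup>2" for x
    by algebra
  show ?thesis
    using f g square_integrable_mult[OF f g]
    by (auto simp: square_integrable_def eq)
qed

lemma square_integrable_scaled: "square_integrable \<mu> f \<Longrightarrow> square_integrable \<mu> (\<lambda>x. c * f x)"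
  by (auto simp: square_integrable_def power_mult_distrib)

lemma square_integrable_zero: "square_integrable \<mu> (\<lambda>_. 0)"
  by (simp add: square_integrable_def)

lemma square_integrable_sum:
  "(\<And>i. i \<in> S \<Longrightarrow> square_integrable \<mu> (f i)) \<Longrightarrow> square_integrable \<mu> (\<lambda>x. \<Sum>i\<in>S. c i * f i x)"
proof (induction S rule: infinite_finite_induct)
  case (insert i S)
  then have "square_integrable \<mu> (\<lambda>x. (\<Sum>i\<in>S. c i * f i x) + c i * f i x)"
    by (intro square_integrable_add_scaled) auto
  with insert show ?case by (simp add: add.commute)
qed (auto intro: square_integrable_zero)

lemma integral_power2_add_scaled:
  assumes f: "square_integrable \<mu> f" and g: "square_integrable \<mu> g"
  shows "(\<integral>x. (f x + c * g x)\<^sup>2 \<partial>\<mu>) =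
    (\<integral>x. (f x)\<^sup>2 \<partial>\<mu>) + 2 * c * (\<integral>x. f x * g x \<partial>\<mu>) + c\<^sup>2 * (\<integral>x. (g x)\<^sup>2 \<partial>\<mu>)"
proof -
  have eq: "(f x + c * g x)\<^sup>2 = (f x)\<^sup>2 + 2 * c * (f x * g x) + c\<^sup>2 * (g x)\<^sup>2" for x
    by algebra
  show ?thesis
    using f g square_integrable_mult[OF f g] by (simp add: square_integrable_def eq)
qed

lemma integral_Cauchy_Schwarz:
  assumes f: "square_integrable \<mu> f" and g: "square_integrable \<mu> g"
  shows "(\<integral>x. f x * g x \<partial>\<mu>)\<^sup>2 \<le> (\<integral>x. (f x)\<^sup>2 \<partial>\<mu>) * (\<integral>x. (g x)\<^sup>2 \<partial>\<mu>)"
proof -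
  let ?p = "\<integral>x. f x * g x \<partial>\<mu>" and ?F = "\<integral>x. (f x)\<^sup>2 \<partial>\<mu>" and ?G = "\<integral>x. (g x)\<^sup>2 \<partial>\<mu>"
  have nonneg: "0 \<le> ?F + 2 * c * ?p + c\<^sup>2 * ?G" for c
    using integral_power2_add_scaled[OF f g, of c, symmetric] by simp
  show ?thesis
  proof (cases "?G = 0")
    case True
    have "?p = 0"
    proof (rule ccontr)
      assume "?p \<noteq> 0"
      \<comment> \<open>With \<open>?G = 0\<close> the quadratic is affine in \<open>c\<close>, and
        this \<open>c\<close> gives it the value -1.\<close>
      with nonneg[of "- (?F + 1) / (2 * ?p)"] True show False
        by (simp add: field_simps)
    qed
    with True show ?thesis by simp
  next
    case False
    then have "0 < ?G" by (simp add: less_le)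
    \<comment> \<open>The value of the quadratic at its minimiser.\<close>
    have "?F + 2 * (- ?p / ?G) * ?p + (- ?p / ?G)\<^sup>2 * ?G = ?F - ?p\<^sup>2 / ?G"
      using False by (simp add: field_simps power2_eq_square)
    with nonneg[of "- ?p / ?G"] have "?p\<^sup>2 / ?G \<le> ?F" by simp
    with \<open>0 < ?G\<close> show ?thesis by (simp add: field_simps)
  qed
qed

text \<open>Expand the nonnegative norm of \<open>f\<close> minus its projection \<open>s\<close>:
  the pairing of \<open>f\<close> with \<open>s\<close> and the squared norm of \<open>s\<close> are
  both the sum of the squared coefficients.\<close>

lemma Bessel_inequality:
  assumes S: "finite S" and f: "square_integrable \<mu> f"
    and e: "\<And>i. i \<in> S \<Longrightarrow> square_integrable \<mu> (e i)"
    and orth: "\<And>i j. i \<in> S \<Longrightarrow> j \<in> S \<Longrightarrow> (\<integral>x. e i x * e j x \<partial>\<mu>) = (if i = j then 1 else 0)"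
  shows "(\<Sum>i\<in>S. (\<integral>x. f x * e i x \<partial>\<mu>)\<^sup>2) \<le> (\<integral>x. (f x)\<^sup>2 \<partial>\<mu>)"
proof -
  define c where "c i = (\<integral>x. f x * e i x \<partial>\<mu>)" for i
  define s where "s x = (\<Sum>i\<in>S. c i * e i x)" for x
  have s: "square_integrable \<mu> s"
    unfolding s_def using e by (rule square_integrable_sum)
  have "(\<integral>x. f x * s x \<partial>\<mu>) = (\<integral>x. (\<Sum>i\<in>S. c i * (f x * e i x)) \<partial>\<mu>)"
    by (simp add: s_def sum_distrib_left ac_simps)
  also have "\<dots> = (\<Sum>i\<in>S. c i * c i)"
    using square_integrable_mult[OF f e]
    by (subst Bochner_Integration.integral_sum) (auto simp: c_def)
  finally have fs: "(\<integral>x. f x * s x \<partial>\<mu>) = (\<Sum>i\<in>S. c i * c i)" .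
  have "(\<integral>x. e i x * s x \<partial>\<mu>) = c i" if i: "i \<in> S" for i
  proof -
    have "(\<integral>x. e i x * s x \<partial>\<mu>) = (\<integral>x. (\<Sum>j\<in>S. c j * (e i x * e j x)) \<partial>\<mu>)"
      by (simp add: s_def sum_distrib_left ac_simps)
    also have "\<dots> = (\<Sum>j\<in>S. c j * (\<integral>x. e i x * e j x \<partial>\<mu>))"
      using square_integrable_mult[OF e e] i
      by (subst Bochner_Integration.integral_sum) auto
    also have "\<dots> = (\<Sum>j\<in>S. if i = j then c j else 0)"
      using i by (intro sum.cong) (auto simp: orth)
    finally show ?thesis using i S by simp
  qed
  note es = this
  have "(\<integral>x. (s x)\<^sup>2 \<partial>\<mu>) = (\<integral>x. (\<Sum>i\<in>S. c i * (e i x * s x)) \<partial>\<mu>)"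
    unfolding power2_eq_square mult.assoc[symmetric] sum_distrib_right[symmetric] s_def[symmetric] ..
  also have "\<dots> = (\<Sum>i\<in>S. c i * c i)"
    using square_integrable_mult[OF e s] es
    by (subst Bochner_Integration.integral_sum) auto
  finally have ss: "(\<integral>x. (s x)\<^sup>2 \<partial>\<mu>) = (\<Sum>i\<in>S. c i * c i)" .
  have "0 \<le> (\<integral>x. (f x + (-1) * s x)\<^sup>2 \<partial>\<mu>)" by simp
  then show ?thesis
    unfolding integral_power2_add_scaled[OF f s] fs ss
    by (simp add: c_def power2_eq_square)
qed

lemma AE_eq_0_if_integral_power2_eq_0:
  assumes "square_integrable \<mu> f" "(\<integral>x. (f x)\<^sup>2 \<partial>\<mu>) = 0"
  shows "AE x in \<mu>. f x = 0"
  using integral_nonneg_eq_0_iff_AE[OF square_integrable_power2[OF assms(1)]] assms(2) by simp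

section \<open>A Lagrange multiplier for a quadratic programme\<close>

text \<open>Along a ray, \<open>n0 + 2 * \<epsilon> * l1 + \<epsilon>\<^sup>2 * n\<close> is the
  budget used and \<open>2 * \<epsilon> * l2 + \<epsilon>\<^sup>2 * m\<close> the gain. If the
  constraint is slack or strictly relaxed to first order, all small steps are feasible, and dividing
  the gain by \<epsilon> leaves its slope in the limit.\<close>

lemma first_order_quadratic:
  fixes l1 l2 n0 n m C :: real
  assumes opt: "\<And>\<epsilon>. 0 < \<epsilon> \<Longrightarrow> n0 + 2 * \<epsilon> * l1 + \<epsilon>\<^sup>2 * n \<le> C \<Longrightarrow> 2 * \<epsilon> * l2 + \<epsilon>\<^sup>2 * m \<le> 0"
    and "n0 \<le> C" and "l1 < 0 \<or> n0 < C"
  shows "l2 \<le> 0"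
proof -
  let ?F = "at_right (0::real)"
  have "\<forall>\<^sub>F \<epsilon> in ?F. n0 + 2 * \<epsilon> * l1 + \<epsilon>\<^sup>2 * n \<le> C"
  proof (cases "n0 < C")
    case True
    have "((\<lambda>\<epsilon>. n0 + 2 * \<epsilon> * l1 + \<epsilon>\<^sup>2 * n) \<longlongrightarrow> n0 + 2 * 0 * l1 + 0\<^sup>2 * n) ?F"
      by (intro tendsto_intros)
    from order_tendstoD(2)[OF this, of C] True show ?thesis
      by (auto elim: eventually_mono)
  next
    case False
    then have "l1 < 0" "n0 = C" using assms by auto
    have "((\<lambda>\<epsilon>. 2 * l1 + \<epsilon> * n) \<longlongrightarrow> 2 * l1 + 0 * n) ?F"
      by (intro tendsto_intros)
    from order_tendstoD(2)[OF this, of 0] \<open>l1 < 0\<close>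
    have "\<forall>\<^sub>F \<epsilon> in ?F. 2 * l1 + \<epsilon> * n < 0" by simp
    with eventually_at_right_less[of 0] show ?thesis
    proof eventually_elim
      case (elim \<epsilon>)
      then have "\<epsilon> * (2 * l1 + \<epsilon> * n) \<le> 0"
        by (intro mult_nonneg_nonpos) auto
      then show ?case using \<open>n0 = C\<close> by (simp add: algebra_simps power2_eq_square)
    qed
  qed
  with eventually_at_right_less[of 0] have "\<forall>\<^sub>F \<epsilon> in ?F. 2 * l2 + \<epsilon> * m \<le> 0"
  proof eventually_elim
    case (elim \<epsilon>)
    then have "\<epsilon> * (2 * l2 + \<epsilon> * m) \<le> 0"
      using opt[of \<epsilon>] by (simp add: algebra_simps power2_eq_square)
    with elim show ?case by (simp add: mult_le_0_iff)
  qed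
  moreover have "((\<lambda>\<epsilon>. 2 * l2 + \<epsilon> * m) \<longlongrightarrow> 2 * l2 + 0 * m) ?F"
    by (intro tendsto_intros)
  ultimately have "2 * l2 + 0 * m \<le> 0"
    by (intro tendsto_upperbound[of _ _ ?F]) auto
  then show ?thesis by simp
qed

text \<open>\<open>S\<close> collects the pairs of first variations of constraint and objective. A
  linear subspace of the plane that misses the open quadrant \<open>x < 0\<close>,
  \<open>y > 0\<close> and is not contained in the axis \<open>x = 0\<close> is a line of
  nonnegative slope; this slope is the multiplier.\<close>

lemma multiplier_exists:
  fixes S :: "(real \<times> real) set"
  assumes lin: "\<And>x y x' y' c. (x, y) \<in> S \<Longrightarrow> (x', y') \<in> S \<Longrightarrow> (x + c * x', y + c * y') \<in> S"
    and sign: "\<And>x y. (x, y) \<in> S \<Longrightarrow> x < 0 \<Longrightarrow> y \<le> 0"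
    and ne: "(x0, y0) \<in> S" "x0 \<noteq> 0"
  obtains \<mu> where "\<mu> \<ge> 0" "\<And>x y. (x, y) \<in> S \<Longrightarrow> y = \<mu> * x"
proof -
  define \<mu> where "\<mu> = y0 / x0"
  have zero: "(0, 0) \<in> S"
    using lin[OF ne(1) ne(1), of "-1"] by simp
  have scale: "(c * x, c * y) \<in> S" if "(x, y) \<in> S" for c x y
    using lin[OF zero that] by simp
  have le: "y \<le> 0" if "(0, y) \<in> S" for y
  proof -
    \<comment> \<open>The sign condition says nothing at \<open>x = 0\<close>, so the point is
      tilted slightly into \<open>x < 0\<close> and the tilt is sent to zero.\<close>
    have "(- 1, - y0 / x0) \<in> S" using scale[OF ne(1), of "- 1 / x0"] ne(2) by simp
    from lin[OF that this] have "y + \<delta> * (- y0 / x0) \<le> 0" if "\<delta> > 0" for \<delta>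
      using sign that by force
    then have "\<forall>\<^sub>F \<delta> in at_right 0. y + \<delta> * (- y0 / x0) \<le> 0"
      by (auto simp: eventually_at_filter)
    moreover have "((\<lambda>\<delta>. y + \<delta> * (- y0 / x0)) \<longlongrightarrow> y + 0 * (- y0 / x0)) (at_right 0)"
      by (intro tendsto_intros)
    ultimately have "y + 0 * (- y0 / x0) \<le> 0"
      by (intro tendsto_upperbound[of _ _ "at_right (0::real)"]) auto
    then show ?thesis by simp
  qed
  have "\<mu> \<ge> 0"
    using sign[OF scale[OF ne(1), of "- 1 / x0"]] ne(2) by (simp add: \<mu>_def)
  moreover have "y = \<mu> * x" if "(x, y) \<in> S" for x y
  proof -
    have "(0, y - \<mu> * x) \<in> S"
      using lin[OF that ne(1), of "- x / x0"] ne(2) by (simp add: \<mu>_def mult.commute)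
    with le[OF this] le scale[OF this, of "-1"] show ?thesis by force
  qed
  ultimately show ?thesis by (rule that)
qed

section \<open>Families of processes as functions on a product space\<close>

locale graphon_setting = prob_space M
  for M :: "'w measure" +
  fixes \<nu> :: "real measure" and T :: real and W :: "real \<Rightarrow> real \<Rightarrow> real"
  assumes extends: "extends_Lebesgue \<nu>" and graphon: "graphon W"
begin

sublocale nu: prob_space \<nu>
  using extends by (simp add: extends_Lebesgue_def)

sublocale time: finite_measure "time_measure T"
proof (rule finite_measureI)
  show "emeasure (time_measure T) (space (time_measure T)) \<noteq> \<infinity>"
    by (cases "0 \<le> T") (simp_all add: emeasure_restrict_space space_restrict_space)
qed

abbreviation N :: "(real \<times> 'w) measure" where
  "N \<equiv> time_measure T \<Otimes>\<^sub>M M"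

abbreviation X :: "(real \<times> real \<times> 'w) measure" where
  "X \<equiv> \<nu> \<Otimes>\<^sub>M N"

abbreviation flat :: "(real \<Rightarrow> 'w process) \<Rightarrow> real \<times> real \<times> 'w \<Rightarrow> real" where
  "flat a \<equiv> (\<lambda>(x, t, \<omega>). a x t \<omega>)"

sublocale timeM: pair_sigma_finite "time_measure T" M ..

sublocale N: finite_measure N
  by (intro finite_measure_pair_measure) unfold_locales

sublocale X: pair_sigma_finite \<nu> N ..

sublocale XX: pair_sigma_finite \<nu> \<nu> ..

lemma space_nu [simp]: "space \<nu> = {0..1}"
  using extends by (simp add: extends_Lebesgue_def)

section \<open>Lebesgue measure as an image of its extension\<close>

lemma measurable_ident_Leb01: "(\<lambda>x. x) \<in> measurable \<nu> Leb01"
  using extends by (intro measurableI) (auto simp: extends_Lebesgue_def space_restrict_space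
      Int_absorb2 sets.sets_into_space[THEN subsetD])

text \<open>The identity is measure preserving from \<nu> to \<open>Leb01\<close>, so the transfer
  of integrals, integrability and null sets reduces to the rules for image measures.\<close>

lemma Leb01_eq_distr: "Leb01 = distr \<nu> Leb01 (\<lambda>x. x)"
proof (rule measure_eqI)
  fix A assume A: "A \<in> sets Leb01"
  then have "A \<subseteq> {0..1}" using sets.sets_into_space[OF A] by (simp add: space_restrict_space)
  then show "emeasure Leb01 A = emeasure (distr \<nu> Leb01 (\<lambda>x. x)) A"
    using A extends measurable_ident_Leb01
    by (simp add: emeasure_distr extends_Lebesgue_def Int_absorb2)
qed simp

lemma borel_measurable_Leb01D: "f \<in> borel_measurable Leb01 \<Longrightarrow> f \<in> borel_measurable \<nu>"
  using measurable_compose[OF measurable_ident_Leb01] .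

lemma integral_Leb01: "f \<in> borel_measurable Leb01 \<Longrightarrow> (\<integral>x. f x \<partial>Leb01) = (\<integral>x. f x \<partial>\<nu>)" for f :: "real \<Rightarrow> real"
  by (subst Leb01_eq_distr) (rule integral_distr[OF measurable_ident_Leb01])

lemma integrable_Leb01D: "integrable Leb01 f \<Longrightarrow> integrable \<nu> f" for f :: "real \<Rightarrow> real"
  using integrable_distr[OF measurable_ident_Leb01] Leb01_eq_distr by metis

lemma AE_Leb01D: "AE x in Leb01. P x \<Longrightarrow> AE x in \<nu>. P x"
  using AE_distrD[OF measurable_ident_Leb01] Leb01_eq_distr by metis

lemma L2_square_integrable: "f \<in> L2 Leb01 \<Longrightarrow> square_integrable \<nu> f"
  by (auto simp: L2_def square_integrable_def intro: borel_measurable_Leb01D integrable_Leb01D)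

lemma L2_inner_Leb01:
  "f \<in> L2 Leb01 \<Longrightarrow> g \<in> L2 Leb01 \<Longrightarrow> L2_inner Leb01 f g = (\<integral>x. f x * g x \<partial>\<nu>)"
  unfolding L2_inner_def by (intro integral_Leb01) (auto simp: L2_def)

section \<open>The kernel and its sections\<close>

lemma W_measurable: "(\<lambda>(x, y). W x y) \<in> borel_measurable (\<nu> \<Otimes>\<^sub>M \<nu>)"
proof -
  have "(\<lambda>p. (fst p, snd p)) \<in> measurable (\<nu> \<Otimes>\<^sub>M \<nu>) (Leb01 \<Otimes>\<^sub>M Leb01)"
    using measurable_compose[OF measurable_fst measurable_ident_Leb01]
      measurable_compose[OF measurable_snd measurable_ident_Leb01]
    by (rule measurable_Pair)
  moreover have "(\<lambda>(x, y). W x y) \<in> borel_measurable (Leb01 \<Otimes>\<^sub>M Leb01)"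
    using graphon by (simp add: graphon_def)
  ultimately show ?thesis using measurable_compose by fastforce
qed

lemma W_abs_le: "x \<in> {0..1} \<Longrightarrow> y \<in> {0..1} \<Longrightarrow> \<bar>W x y\<bar> \<le> 1"
  using graphon by (auto simp: graphon_def)

lemma W_sym: "x \<in> {0..1} \<Longrightarrow> y \<in> {0..1} \<Longrightarrow> W x y = W y x"
  using graphon by (auto simp: graphon_def)

lemma W_section_measurable: "x \<in> {0..1} \<Longrightarrow> W x \<in> borel_measurable Leb01"
  using graphon measurable_Pair2[of "\<lambda>(x, y). W x y" Leb01 Leb01 borel x]
  by (simp add: graphon_def space_restrict_space)

text \<open>Membership in \<open>L2 Leb01\<close>, stronger than square integrability over \<nu>, is
  what allows a section to be approximated by the eigenbasis.\<close>

lemma W_section_L2: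
  assumes x: "x \<in> {0..1}"
  shows "W x \<in> L2 Leb01"
proof -
  have "finite_measure Leb01"
    by (rule finite_measureI) (simp add: emeasure_restrict_space space_restrict_space)
  then have "integrable Leb01 (\<lambda>y. (W x y)\<^sup>2)"
  proof (rule finite_measure.integrable_const_bound)
    show "AE y in Leb01. norm ((W x y)\<^sup>2) \<le> 1"
      using W_abs_le[OF x] by (intro AE_I2) (simp add: space_restrict_space abs_square_le_1)
    show "(\<lambda>y. (W x y)\<^sup>2) \<in> borel_measurable Leb01"
      using W_section_measurable[OF x] by measurable
  qed
  then show ?thesis using W_section_measurable[OF x] by (simp add: L2_def)
qed

lemmas W_section = L2_square_integrable[OF W_section_L2]

lemma W_section_norm_le:
  assumes x: "x \<in> {0..1}"
  shows "(\<integral>y. (W x y)\<^sup>2 \<partial>\<nu>) \<le> 1"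
proof -
  have "(\<integral>y. (W x y)\<^sup>2 \<partial>\<nu>) \<le> (\<integral>y. 1 \<partial>\<nu>)"
    using square_integrable_power2[OF W_section[OF x]] W_abs_le[OF x]
    by (intro integral_mono) (auto simp: abs_square_le_1)
  then show ?thesis using nu.prob_space by simp
qed

section \<open>Sections, tensor products and norms of families\<close>

lemma square_integrable_sections:
  assumes f: "square_integrable X f"
  shows "AE x in \<nu>. square_integrable N (\<lambda>n. f (x, n))"
    and "AE n in N. square_integrable \<nu> (\<lambda>x. f (x, n))"
proof -
  note meas = square_integrable_measurable[OF f]
  show "AE x in \<nu>. square_integrable N (\<lambda>n. f (x, n))"
    using X.AE_integrable_fst'[OF square_integrable_power2[OF f]] AE_space
  proof eventually_elim
    case (elim x)
    then show ?case using measurable_Pair2[OF meas, of x] by (simp add: square_integrable_def)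
  qed
  have "integrable X (case_prod (\<lambda>x n. (f (x, n))\<^sup>2))"
    using square_integrable_power2[OF f] by (simp add: case_prod_unfold)
  from X.AE_integrable_snd[OF this] AE_space
  show "AE n in N. square_integrable \<nu> (\<lambda>x. f (x, n))"
  proof eventually_elim
    case (elim n)
    then show ?case using measurable_Pair1[OF meas, of n] by (simp only: square_integrable_def simp_thms)
  qed
qed

lemma square_integrable_tensor:
  assumes f: "square_integrable \<nu> f" and g: "square_integrable N g"
  shows "square_integrable X (\<lambda>(x, n). f x * g n)"
proof -
  note [measurable] = square_integrable_measurable[OF f] square_integrable_measurable[OF g]
  have "integrable X (\<lambda>(x, n). (f x)\<^sup>2 * (g n)\<^sup>2)"
    using square_integrable_power2[OF f] square_integrable_power2[OF g]
    by (intro X.Fubini_integrable) auto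
  then show ?thesis
    by (auto simp: square_integrable_def case_prod_unfold power_mult_distrib)
qed

lemma nn_finite_iff_square_integrable:
  assumes [measurable]: "f \<in> borel_measurable N"
  shows "(\<integral>\<^sup>+t. (\<integral>\<^sup>+\<omega>. ennreal ((f (t, \<omega>))\<^sup>2) \<partial>M) \<partial>time_measure T) < \<infinity> \<longleftrightarrow> square_integrable N f"
proof -
  have "(\<integral>\<^sup>+t. (\<integral>\<^sup>+\<omega>. ennreal ((f (t, \<omega>))\<^sup>2) \<partial>M) \<partial>time_measure T) = (\<integral>\<^sup>+n. ennreal ((f n)\<^sup>2) \<partial>N)"
    by (rule nn_integral_fst) simp
  then show ?thesis
    by (simp add: square_integrable_def integrable_iff_bounded)
qed

lemma sets_N: "sets (restrict_space borel {0..T} \<Otimes>\<^sub>M M) = sets N"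
  by (intro sets_pair_measure_cong) (simp_all add: sets_restrict_space)

lemma flat_section_measurable:
  "flat a \<in> borel_measurable X \<Longrightarrow> x \<in> {0..1} \<Longrightarrow> (\<lambda>(t, \<omega>). a x t \<omega>) \<in> borel_measurable N"
  using measurable_Pair2[of "flat a" \<nu> N borel x] by simp

text \<open>Joint square integrability on \<open>X\<close> controls only almost every section,
  whereas membership constrains every member; hence both conditions appear side by side.\<close>

lemma Ainf_space_iff:
  "a \<in> Ainf_space \<nu> M F T \<longleftrightarrow>
    (\<forall>x\<in>{0..1}. progressively_measurable F T (a x) \<and> square_integrable N (\<lambda>(t, \<omega>). a x t \<omega>)) \<and>
    square_integrable X (flat a)"
proof -
  have sets_X: "sets (\<nu> \<Otimes>\<^sub>M restrict_space borel {0..T} \<Otimes>\<^sub>M M) = sets X"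
    by (intro sets_pair_measure_cong sets_N refl)
  note meas_eq = measurable_cong_sets[OF sets_X refl]
  show ?thesis
  proof (cases "flat a \<in> borel_measurable X")
    case True
    note [measurable] = True
    have 1: "(\<integral>\<^sup>+t. (\<integral>\<^sup>+\<omega>. ennreal ((a x t \<omega>)\<^sup>2) \<partial>M) \<partial>time_measure T) < \<infinity> \<longleftrightarrow>
        square_integrable N (\<lambda>(t, \<omega>). a x t \<omega>)" if "x \<in> {0..1}" for x
      using nn_finite_iff_square_integrable[OF flat_section_measurable[OF True that]] by simp
    have "(\<integral>\<^sup>+x. (\<integral>\<^sup>+t. (\<integral>\<^sup>+\<omega>. ennreal ((a x t \<omega>)\<^sup>2) \<partial>M) \<partial>time_measure T) \<partial>\<nu>) =
        (\<integral>\<^sup>+x. (\<integral>\<^sup>+n. ennreal ((flat a (x, n))\<^sup>2) \<partial>N) \<partial>\<nu>)"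
    proof (rule nn_integral_cong)
      fix x assume "x \<in> space \<nu>"
      then have [measurable]: "(\<lambda>(t, \<omega>). a x t \<omega>) \<in> borel_measurable N"
        using flat_section_measurable[OF True] by simp
      have "(\<integral>\<^sup>+t. (\<integral>\<^sup>+\<omega>. ennreal ((case (t, \<omega>) of (t, \<omega>) \<Rightarrow> a x t \<omega>)\<^sup>2) \<partial>M) \<partial>time_measure T) =
          (\<integral>\<^sup>+n. ennreal ((case n of (t, \<omega>) \<Rightarrow> a x t \<omega>)\<^sup>2) \<partial>N)"
        by (rule nn_integral_fst) simp
      then show "(\<integral>\<^sup>+t. (\<integral>\<^sup>+\<omega>. ennreal ((a x t \<omega>)\<^sup>2) \<partial>M) \<partial>time_measure T) =
          (\<integral>\<^sup>+n. ennreal ((flat a (x, n))\<^sup>2) \<partial>N)" by simp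
    qed
    also have "\<dots> = (\<integral>\<^sup>+p. ennreal ((flat a p)\<^sup>2) \<partial>X)"
      by (rule timeM.P.nn_integral_fst) simp
    finally have 2: "(\<integral>\<^sup>+x. (\<integral>\<^sup>+t. (\<integral>\<^sup>+\<omega>. ennreal ((a x t \<omega>)\<^sup>2) \<partial>M) \<partial>time_measure T) \<partial>\<nu>) < \<infinity> \<longleftrightarrow>
        square_integrable X (flat a)"
      using True by (simp add: square_integrable_def integrable_iff_bounded)
    show ?thesis
      unfolding Ainf_space_def A_space_def mem_Collect_eq meas_eq 2
      by (simp only: 1 True simp_thms cong: ball_cong)
  next
    case False
    then show ?thesis
      unfolding Ainf_space_def mem_Collect_eq meas_eq by (auto dest: square_integrable_measurable)
  qed
qed

lemma Ainf_spaceD: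
  assumes "a \<in> Ainf_space \<nu> M F T"
  shows "square_integrable X (flat a)"
    and "x \<in> {0..1} \<Longrightarrow> square_integrable N (\<lambda>(t, \<omega>). a x t \<omega>)"
    and "x \<in> {0..1} \<Longrightarrow> progressively_measurable F T (a x)"
  using assms by (auto simp: Ainf_space_iff)

lemma A_norm_sq_eq:
  assumes "square_integrable N (\<lambda>(t, \<omega>). b t \<omega>)"
  shows "A_norm_sq M T b = (\<integral>(t, \<omega>). (b t \<omega>)\<^sup>2 \<partial>N)"
  using timeM.integral_fst'[OF square_integrable_power2[OF assms]]
  by (simp add: A_norm_sq_def case_prod_unfold)

lemma Ainf_norm_sq_eq:
  assumes a: "a \<in> Ainf_space \<nu> M F T"
  shows "Ainf_norm_sq \<nu> M T a = (\<integral>p. (flat a p)\<^sup>2 \<partial>X)"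
proof -
  have "Ainf_norm_sq \<nu> M T a = (\<integral>x. (\<integral>n. (flat a (x, n))\<^sup>2 \<partial>N) \<partial>\<nu>)"
    unfolding Ainf_norm_sq_def
    using A_norm_sq_eq[OF Ainf_spaceD(2)[OF a]]
    by (intro Bochner_Integration.integral_cong refl) (simp add: A_norm_sq_def case_prod_unfold)
  also have "\<dots> = (\<integral>p. (flat a p)\<^sup>2 \<partial>X)"
    by (rule X.integral_fst'[OF square_integrable_power2[OF Ainf_spaceD(1)[OF a]]])
  finally show ?thesis .
qed

lemma Ainf_norm_sq_integrable:
  assumes a: "a \<in> Ainf_space \<nu> M F T"
  shows "has_bochner_integral \<nu> (\<lambda>x. A_norm_sq M T (a x)) (Ainf_norm_sq \<nu> M T a)"
proof -
  have "integrable \<nu> (\<lambda>x. \<integral>n. (flat a (x, n))\<^sup>2 \<partial>N)"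
    by (rule X.integrable_fst'[OF square_integrable_power2[OF Ainf_spaceD(1)[OF a]]])
  also have "?this \<longleftrightarrow> integrable \<nu> (\<lambda>x. A_norm_sq M T (a x))"
    by (intro Bochner_Integration.integrable_cong refl)
      (simp add: A_norm_sq_eq[OF Ainf_spaceD(2)[OF a]] case_prod_unfold)
  finally show ?thesis
    by (simp add: has_bochner_integral_iff Ainf_norm_sq_def A_norm_sq_def)
qed

section \<open>Linear combinations of families\<close>

lemma square_integrable_flat_add_scaled:
  assumes "square_integrable X (flat a)" "square_integrable X (flat b)"
  shows "square_integrable X (flat (\<lambda>x t \<omega>. a x t \<omega> + c * b x t \<omega>))"
  using square_integrable_add_scaled[OF assms, of c] by (simp add: case_prod_unfold)

lemma progressively_measurable_add_scaled:
  assumes "progressively_measurable F T a" "progressively_measurable F T b"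
  shows "progressively_measurable F T (\<lambda>t \<omega>. a t \<omega> + c * b t \<omega>)"
  unfolding progressively_measurable_def
proof
  fix t assume "t \<in> {0..T}"
  then have [measurable]: "(\<lambda>p. a (fst p) (snd p)) \<in> borel_measurable (restrict_space borel {0..t} \<Otimes>\<^sub>M F t)"
      "(\<lambda>p. b (fst p) (snd p)) \<in> borel_measurable (restrict_space borel {0..t} \<Otimes>\<^sub>M F t)"
    using assms by (auto simp: progressively_measurable_def case_prod_unfold)
  show "(\<lambda>(s, \<omega>). a s \<omega> + c * b s \<omega>) \<in> borel_measurable (restrict_space borel {0..t} \<Otimes>\<^sub>M F t)"
    unfolding case_prod_unfold by measurable
qed

lemma Ainf_space_add_scaled:
  assumes a: "a \<in> Ainf_space \<nu> M F T" and b: "b \<in> Ainf_space \<nu> M F T"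
  shows "(\<lambda>x t \<omega>. a x t \<omega> + c * b x t \<omega>) \<in> Ainf_space \<nu> M F T"
  unfolding Ainf_space_iff
proof (intro conjI ballI)
  show "square_integrable X (flat (\<lambda>x t \<omega>. a x t \<omega> + c * b x t \<omega>))"
    using Ainf_spaceD(1)[OF a] Ainf_spaceD(1)[OF b] by (rule square_integrable_flat_add_scaled)
  fix x :: real assume x: "x \<in> {0..1}"
  show "progressively_measurable F T (\<lambda>t \<omega>. a x t \<omega> + c * b x t \<omega>)"
    using Ainf_spaceD(3)[OF a x] Ainf_spaceD(3)[OF b x]
    by (rule progressively_measurable_add_scaled)
  show "square_integrable N (\<lambda>(t, \<omega>). a x t \<omega> + c * b x t \<omega>)"
    using square_integrable_add_scaled[OF Ainf_spaceD(2)[OF a x] Ainf_spaceD(2)[OF b x], of c]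
    by (simp add: case_prod_unfold)
qed

lemma Ainf_space_zero: "(\<lambda>x t \<omega>. 0) \<in> Ainf_space \<nu> M F T"
  using square_integrable_zero[of N] square_integrable_zero[of X]
  by (simp add: Ainf_space_iff progressively_measurable_def case_prod_unfold)

lemma Ainf_norm_sq_add_scaled:
  assumes a: "a \<in> Ainf_space \<nu> M F T" and b: "b \<in> Ainf_space \<nu> M F T"
  shows "Ainf_norm_sq \<nu> M T (\<lambda>x t \<omega>. a x t \<omega> + c * b x t \<omega>) =
    Ainf_norm_sq \<nu> M T a + 2 * c * (\<integral>p. flat a p * flat b p \<partial>X) + c\<^sup>2 * Ainf_norm_sq \<nu> M T b"
  using integral_power2_add_scaled[OF Ainf_spaceD(1)[OF a] Ainf_spaceD(1)[OF b], of c]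
  by (simp add: Ainf_norm_sq_eq[OF a] Ainf_norm_sq_eq[OF b]
      Ainf_norm_sq_eq[OF Ainf_space_add_scaled[OF a b]] case_prod_unfold)

section \<open>The graphon operator and equilibria\<close>

text \<open>The exceptional set is covered by a null rectangle, so no measurability of
  \<open>P\<close> is asked for. The price is a quantifier over all \<open>n\<close> where an
  almost-everywhere statement would be weaker. \<open>AE_X_sndI\<close> is the mirror image.\<close>

lemma AE_X_fstI:
  assumes "AE x in \<nu>. \<forall>n\<in>space N. P (x, n)"
  shows "AE p in X. P p"
proof -
  obtain A where A: "{x \<in> space \<nu>. \<not> (\<forall>n\<in>space N. P (x, n))} \<subseteq> A" "A \<in> null_sets \<nu>"
    using assms by (auto simp: eventually_ae_filter)
  from timeM.P.times_in_null_sets1[OF A(2) sets.top]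
  have "A \<times> space N \<in> null_sets X" .
  moreover have "{p \<in> space X. \<not> P p} \<subseteq> A \<times> space N"
    using A(1) by (fastforce simp: space_pair_measure)
  ultimately show ?thesis by (auto simp: eventually_ae_filter)
qed

lemma AE_X_sndI:
  assumes "AE n in N. \<forall>x\<in>{0..1}. P (x, n)"
  shows "AE p in X. P p"
proof -
  obtain A where A: "{n \<in> space N. \<not> (\<forall>x\<in>{0..1}. P (x, n))} \<subseteq> A" "A \<in> null_sets N"
    using assms by (auto simp: eventually_ae_filter)
  from timeM.P.times_in_null_sets2[OF sets.top A(2)]
  have "space \<nu> \<times> A \<in> null_sets X" .
  moreover have "{p \<in> space X. \<not> P p} \<subseteq> space \<nu> \<times> A"
    using A(1) by (fastforce simp: space_pair_measure)
  ultimately show ?thesis by (auto simp: eventually_ae_filter)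
qed

lemma AE_X_snd:
  assumes "AE p in X. P p"
  shows "AE n in N. AE x in \<nu>. P (x, n)"
proof -
  interpret NX: pair_sigma_finite N \<nu> ..
  have "AE p in N \<Otimes>\<^sub>M \<nu>. P (case p of (n, x) \<Rightarrow> (x, n))"
    using assms AE_distrD[OF measurable_pair_swap'] X.distr_pair_swap by metis
  from NX.AE_pair[OF this] show ?thesis by simp
qed

lemma integrable_W_mult:
  assumes "x \<in> {0..1}" "square_integrable \<nu> g"
  shows "integrable \<nu> (\<lambda>y. W x y * g y)"
  using square_integrable_mult[OF W_section[OF assms(1)] assms(2)] .

lemma graphon_op_add_scaled:
  assumes "x \<in> {0..1}" "square_integrable \<nu> f" "square_integrable \<nu> g"
  shows "graphon_op \<nu> W (\<lambda>y. f y + c * g y) x = graphon_op \<nu> W f x + c * graphon_op \<nu> W g x"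
proof -
  have "W x y * (f y + c * g y) = W x y * f y + c * (W x y * g y)" for y
    by (simp add: algebra_simps)
  then show ?thesis
    using integrable_W_mult[OF assms(1,2)] integrable_W_mult[OF assms(1,3)]
    by (simp add: graphon_op_def)
qed

text \<open>Both \<open>f\<close> and the sections of \<open>W\<close> are Lebesgue measurable, so
  the operator over \<open>Leb01\<close> and the one over \<nu> agree on \<open>f\<close>.\<close>

lemma graphon_op_eigenfunction:
  assumes f: "f \<in> eigenspace W \<kappa>"
  shows "AE x in \<nu>. graphon_op \<nu> W f x = \<kappa> * f x"
proof -
  have L2: "f \<in> L2 Leb01" and ae: "AE x in Leb01. graphon_op Leb01 W f x = \<kappa> * f x"
    using f by (auto simp: eigenspace_def)
  from AE_Leb01D[OF ae] AE_space[of \<nu>] show ?thesis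
  proof eventually_elim
    case (elim x)
    then have "(\<lambda>y. W x y * f y) \<in> borel_measurable Leb01"
      using W_section_measurable[of x] L2 by (auto simp: L2_def)
    from integral_Leb01[OF this] elim show ?case by (simp add: graphon_op_def)
  qed
qed

text \<open>Fubini and the symmetry of the kernel. Since \<open>W\<close> is bounded by 1, the
  integrand is dominated by the product of \<open>f\<close> and \<open>g\<close>, which are
  integrable because \<nu> is finite.\<close>

lemma graphon_op_adjoint:
  assumes f: "square_integrable \<nu> f" and g: "square_integrable \<nu> g"
  shows "integrable \<nu> (\<lambda>x. graphon_op \<nu> W g x * f x)"
    and "(\<integral>x. graphon_op \<nu> W g x * f x \<partial>\<nu>) = (\<integral>y. g y * graphon_op \<nu> W f y \<partial>\<nu>)"
proof -
  note [measurable] = square_integrable_measurable[OF f] square_integrable_measurable[OF g] W_measurable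
  have fin: "finite_measure \<nu>" by unfold_locales
  have fi: "integrable \<nu> f" and gi: "integrable \<nu> g"
    using square_integrable_integrable[OF fin] f g by auto
  have "integrable (\<nu> \<Otimes>\<^sub>M \<nu>) (\<lambda>(x, y). f x * g y)"
    using fi gi by (intro XX.Fubini_integrable) (auto simp: abs_mult)
  then have int: "integrable (\<nu> \<Otimes>\<^sub>M \<nu>) (\<lambda>(x, y). W x y * g y * f x)"
  proof (rule Bochner_Integration.integrable_bound)
    show "(\<lambda>(x, y). W x y * g y * f x) \<in> borel_measurable (\<nu> \<Otimes>\<^sub>M \<nu>)"
      using W_measurable by measurable
    show "AE p in \<nu> \<Otimes>\<^sub>M \<nu>. norm (case p of (x, y) \<Rightarrow> W x y * g y * f x)
        \<le> norm (case p of (x, y) \<Rightarrow> f x * g y)"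
    proof (rule AE_I2)
      fix p assume "p \<in> space (\<nu> \<Otimes>\<^sub>M \<nu>)"
      then obtain x y where p: "p = (x, y)" "x \<in> {0..1}" "y \<in> {0..1}"
        by (auto simp: space_pair_measure)
      have "\<bar>W x y\<bar> * \<bar>g y * f x\<bar> \<le> 1 * \<bar>g y * f x\<bar>"
        using W_abs_le[OF p(2,3)] by (intro mult_right_mono) auto
      then show "norm (case p of (x, y) \<Rightarrow> W x y * g y * f x)
          \<le> norm (case p of (x, y) \<Rightarrow> f x * g y)"
        by (simp add: p abs_mult ac_simps)
    qed
  qed
  show "integrable \<nu> (\<lambda>x. graphon_op \<nu> W g x * f x)"
    using XX.integrable_fst'[OF int] by (simp add: graphon_op_def)
  have "(\<integral>x. graphon_op \<nu> W g x * f x \<partial>\<nu>) = (\<integral>x. (\<integral>y. W x y * g y * f x \<partial>\<nu>) \<partial>\<nu>)"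
    by (simp add: graphon_op_def)
  also have "\<dots> = (\<integral>y. (\<integral>x. W x y * g y * f x \<partial>\<nu>) \<partial>\<nu>)"
    using XX.Fubini_integral[OF int] by simp
  also have "\<dots> = (\<integral>y. g y * graphon_op \<nu> W f y \<partial>\<nu>)"
  proof (rule Bochner_Integration.integral_cong[OF refl])
    fix y assume "y \<in> space \<nu>"
    then have "(\<integral>x. W x y * g y * f x \<partial>\<nu>) = (\<integral>x. g y * (W y x * f x) \<partial>\<nu>)"
      by (intro Bochner_Integration.integral_cong refl) (simp add: W_sym)
    then show "(\<integral>x. W x y * g y * f x \<partial>\<nu>) = g y * graphon_op \<nu> W f y"
      by (simp add: graphon_op_def)
  qed
  finally show "(\<integral>x. graphon_op \<nu> W g x * f x \<partial>\<nu>) = (\<integral>y. g y * graphon_op \<nu> W f y \<partial>\<nu>)" .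
qed

lemma eigenspace_square_integrable: "f \<in> eigenspace W \<kappa> \<Longrightarrow> square_integrable \<nu> f"
  by (auto simp: eigenspace_def intro: L2_square_integrable)

lemma graphon_op_inner_eigenfunction:
  assumes f: "f \<in> eigenspace W \<kappa>" and g: "square_integrable \<nu> g"
  shows "(\<integral>x. graphon_op \<nu> W g x * f x \<partial>\<nu>) = \<kappa> * (\<integral>x. g x * f x \<partial>\<nu>)"
proof -
  note sf = eigenspace_square_integrable[OF f]
  note [measurable] = square_integrable_measurable[OF sf] square_integrable_measurable[OF g] W_measurable
  have "(\<integral>x. graphon_op \<nu> W g x * f x \<partial>\<nu>) = (\<integral>y. g y * graphon_op \<nu> W f y \<partial>\<nu>)"
    by (rule graphon_op_adjoint(2)[OF sf g])
  also have "\<dots> = (\<integral>y. \<kappa> * (g y * f y) \<partial>\<nu>)"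
  proof (rule integral_cong_AE)
    show "AE y in \<nu>. g y * graphon_op \<nu> W f y = \<kappa> * (g y * f y)"
      using graphon_op_eigenfunction[OF f] by eventually_elim simp
    show "(\<lambda>y. g y * graphon_op \<nu> W f y) \<in> borel_measurable \<nu>"
      using W_measurable unfolding graphon_op_def by measurable
  qed measurable
  finally show ?thesis by simp
qed

text \<open>Splitting the integral over \<open>y\<close> requires square-integrable sections, which
  are available for almost every \<open>n\<close> only.\<close>

lemma graphon_op_process_add_scaled:
  assumes a: "square_integrable X (flat a)" and b: "square_integrable X (flat b)"
  shows "Ainf_eq \<nu> M T (graphon_op_process \<nu> W (\<lambda>x t \<omega>. a x t \<omega> + c * b x t \<omega>))
    (\<lambda>x t \<omega>. graphon_op_process \<nu> W a x t \<omega> + c * graphon_op_process \<nu> W b x t \<omega>)"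
  unfolding Ainf_eq_def
proof (rule AE_X_sndI)
  show "AE n in N. \<forall>x\<in>{0..1}. case (x, n) of (x, t, \<omega>) \<Rightarrow>
      graphon_op_process \<nu> W (\<lambda>x t \<omega>. a x t \<omega> + c * b x t \<omega>) x t \<omega> =
      graphon_op_process \<nu> W a x t \<omega> + c * graphon_op_process \<nu> W b x t \<omega>"
    using square_integrable_sections(2)[OF a] square_integrable_sections(2)[OF b]
  proof eventually_elim
    case (elim n)
    then show ?case
      by (cases n) (simp add: graphon_op_process_def graphon_op_add_scaled)
  qed
qed

section \<open>Equilibria as a linear relation\<close>

lemma equilibriumD:
  assumes "equilibrium \<nu> M F T \<beta> W \<eta> a z"
  shows "a \<in> Ainf_space \<nu> M F T" "z \<in> Ainf_space \<nu> M F T"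
    and "AE (x, t, \<omega>) in X. a x t \<omega> - \<beta> * graphon_op_process \<nu> W a x t \<omega> = \<eta> x t \<omega>"
    and "AE (x, t, \<omega>) in X. z x t \<omega> = graphon_op_process \<nu> W a x t \<omega>"
  using assms by (simp_all add: equilibrium_def Ainf_eq_def)

lemma equilibrium_add_scaled:
  assumes 1: "equilibrium \<nu> M F T \<beta> W \<eta> a z" and 2: "equilibrium \<nu> M F T \<beta> W \<eta>' a' z'"
  shows "equilibrium \<nu> M F T \<beta> W (\<lambda>x t \<omega>. \<eta> x t \<omega> + c * \<eta>' x t \<omega>)
    (\<lambda>x t \<omega>. a x t \<omega> + c * a' x t \<omega>) (\<lambda>x t \<omega>. z x t \<omega> + c * z' x t \<omega>)"
  unfolding equilibrium_def
proof (intro conjI)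
  note lin = graphon_op_process_add_scaled[OF Ainf_spaceD(1)[OF equilibriumD(1)[OF 1]]
      Ainf_spaceD(1)[OF equilibriumD(1)[OF 2]], of c, unfolded Ainf_eq_def]
  show "Ainf_eq \<nu> M T (\<lambda>x t \<omega>. a x t \<omega> + c * a' x t \<omega> -
      \<beta> * graphon_op_process \<nu> W (\<lambda>x t \<omega>. a x t \<omega> + c * a' x t \<omega>) x t \<omega>)
      (\<lambda>x t \<omega>. \<eta> x t \<omega> + c * \<eta>' x t \<omega>)"
    using lin equilibriumD(3)[OF 1] equilibriumD(3)[OF 2] unfolding Ainf_eq_def
    by eventually_elim (auto simp: algebra_simps)
  show "Ainf_eq \<nu> M T (\<lambda>x t \<omega>. z x t \<omega> + c * z' x t \<omega>)
      (graphon_op_process \<nu> W (\<lambda>x t \<omega>. a x t \<omega> + c * a' x t \<omega>))"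
    using lin equilibriumD(4)[OF 1] equilibriumD(4)[OF 2] unfolding Ainf_eq_def
    by eventually_elim (auto simp: algebra_simps)
qed (use 1 2 in \<open>auto intro: Ainf_space_add_scaled equilibriumD\<close>)

lemma progressively_measurable_scaled:
  assumes "progressively_measurable F T a"
  shows "progressively_measurable F T (\<lambda>t \<omega>. c * a t \<omega>)"
  using progressively_measurable_add_scaled[of F "\<lambda>_ _. 0" a c] assms
  by (simp add: progressively_measurable_def case_prod_unfold)

lemma Ainf_space_tensor:
  assumes f: "square_integrable \<nu> f"
    and \<psi>: "progressively_measurable F T \<psi>" "square_integrable N (\<lambda>(t, \<omega>). \<psi> t \<omega>)"
  shows "(\<lambda>x t \<omega>. f x * \<psi> t \<omega>) \<in> Ainf_space \<nu> M F T"
  using square_integrable_tensor[OF f \<psi>(2)] square_integrable_scaled[OF \<psi>(2)]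
    progressively_measurable_scaled[OF \<psi>(1)]
  by (simp add: Ainf_space_iff case_prod_unfold)

text \<open>Fixing the action first and computing the intervention that produces it avoids both an
  inverse of the operator and a division by \<open>1 - \<beta> * \<kappa>\<close>.\<close>

lemma equilibrium_tensor:
  assumes f: "f \<in> eigenspace W \<kappa>"
    and \<psi>: "progressively_measurable F T \<psi>" "square_integrable N (\<lambda>(t, \<omega>). \<psi> t \<omega>)"
  shows "equilibrium \<nu> M F T \<beta> W (\<lambda>x t \<omega>. ((1 - \<beta> * \<kappa>) * f x) * \<psi> t \<omega>)
    (\<lambda>x t \<omega>. f x * \<psi> t \<omega>) (\<lambda>x t \<omega>. (\<kappa> * f x) * \<psi> t \<omega>)"
proof -
  note sf = eigenspace_square_integrable[OF f]
  have op: "AE p in X. case p of (x, t, \<omega>) \<Rightarrow>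
      graphon_op_process \<nu> W (\<lambda>x t \<omega>. f x * \<psi> t \<omega>) x t \<omega> = \<kappa> * f x * \<psi> t \<omega>"
  proof (rule AE_X_fstI)
    show "AE x in \<nu>. \<forall>n\<in>space N. case (x, n) of (x, t, \<omega>) \<Rightarrow>
        graphon_op_process \<nu> W (\<lambda>x t \<omega>. f x * \<psi> t \<omega>) x t \<omega> = \<kappa> * f x * \<psi> t \<omega>"
      using graphon_op_eigenfunction[OF f]
      by eventually_elim (auto simp: graphon_op_process_def graphon_op_def mult.assoc[symmetric])
  qed
  show ?thesis
    unfolding equilibrium_def Ainf_eq_def
  proof (intro conjI)
    show "AE (x, t, \<omega>) in X. f x * \<psi> t \<omega> -
        \<beta> * graphon_op_process \<nu> W (\<lambda>x t \<omega>. f x * \<psi> t \<omega>) x t \<omega> = (1 - \<beta> * \<kappa>) * f x * \<psi> t \<omega>"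
      using op by eventually_elim (auto simp: algebra_simps)
    show "AE (x, t, \<omega>) in X. \<kappa> * f x * \<psi> t \<omega> =
        graphon_op_process \<nu> W (\<lambda>x t \<omega>. f x * \<psi> t \<omega>) x t \<omega>"
      using op by eventually_elim auto
  qed (use sf \<psi> in \<open>auto intro!: Ainf_space_tensor square_integrable_scaled\<close>)
qed

lemma A_inner_eq:
  assumes b: "square_integrable N (\<lambda>(t, \<omega>). b t \<omega>)" and c: "square_integrable N (\<lambda>(t, \<omega>). c t \<omega>)"
  shows "A_inner M T b c = (\<integral>(t, \<omega>). b t \<omega> * c t \<omega> \<partial>N)"
proof -
  have "integrable N (\<lambda>(t, \<omega>). b t \<omega> * c t \<omega>)"
    using square_integrable_mult[OF b c] by (simp add: case_prod_unfold)
  from timeM.integral_snd[OF this] show ?thesis by (simp add: A_inner_def)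
qed

text \<open>At an equilibrium the marginal utility \<open>\<eta> + \<beta> z - a\<close> vanishes, which leaves \<open>1/2 \<parallel>a\<parallel>\<^sup>2\<close>.\<close>
lemma welfare_eq:
  assumes P: "external_effect_condition \<nu> M F T \<beta> W P w"
    and \<theta>: "\<theta> \<in> Ainf_space \<nu> M F T"
    and feas: "feasible \<nu> M F T \<beta> W C \<theta> h a z"
  shows "welfare \<nu> M T \<beta> P \<theta> h a z = (1/2 + w) * Ainf_norm_sq \<nu> M T a"
proof -
  define \<eta> where "\<eta> = (\<lambda>x t \<omega>. \<theta> x t \<omega> + h x t \<omega>)"
  have h: "h \<in> Ainf_space \<nu> M F T" and eq: "equilibrium \<nu> M F T \<beta> W \<eta> a z"
    using feas by (auto simp: feasible_def \<eta>_def)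
  have \<eta>: "\<eta> \<in> Ainf_space \<nu> M F T"
    using Ainf_space_add_scaled[OF \<theta> h, of 1] by (simp add: \<eta>_def)
  note a = equilibriumD(1)[OF eq] and z = equilibriumD(2)[OF eq]
  define y where "y = (\<lambda>x t \<omega>. \<eta> x t \<omega> + \<beta> * z x t \<omega>)"
  have y: "y \<in> Ainf_space \<nu> M F T"
    unfolding y_def using \<eta> z by (rule Ainf_space_add_scaled)
  have "AE p in X. flat y p = flat a p"
    using equilibriumD(3)[OF eq] equilibriumD(4)[OF eq]
    by eventually_elim (auto simp: y_def)
  from X.AE_pair[OF this] have ya: "AE x in \<nu>. AE n in N. flat y (x, n) = flat a (x, n)" .
  have inner: "A_inner M T (a x) (y x) = (\<integral>n. flat a (x, n) * flat y (x, n) \<partial>N)" if "x \<in> {0..1}" for x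
    using A_inner_eq[OF Ainf_spaceD(2)[OF a that] Ainf_spaceD(2)[OF y that]]
    by (simp add: case_prod_unfold)
  \<comment> \<open>Fubini makes the inner products measurable in \<open>x\<close>; they equal the
    inner integrals for every \<open>x\<close>, not merely almost every one.\<close>
  have "integrable X (\<lambda>p. flat a p * flat y p)"
    using Ainf_spaceD(1)[OF a] Ainf_spaceD(1)[OF y] by (rule square_integrable_mult)
  from borel_measurable_integrable[OF X.integrable_fst'[OF this]]
  have inner_meas: "(\<lambda>x. A_inner M T (a x) (y x)) \<in> borel_measurable \<nu>"
    by (rule measurable_cong[THEN iffD1, rotated]) (simp add: inner)
  have inner_ae: "AE x in \<nu>. A_inner M T (a x) (y x) = A_norm_sq M T (a x)"
    using ya AE_space[of \<nu>]
  proof eventually_elim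
    case (elim x)
    then have x: "x \<in> {0..1}" by simp
    note [measurable] = square_integrable_measurable[OF Ainf_spaceD(2)[OF a x]]
        square_integrable_measurable[OF Ainf_spaceD(2)[OF y x]]
    have "(\<integral>n. flat a (x, n) * flat y (x, n) \<partial>N) = (\<integral>n. (flat a (x, n))\<^sup>2 \<partial>N)"
    proof (rule integral_cong_AE)
      show "AE n in N. flat a (x, n) * flat y (x, n) = (flat a (x, n))\<^sup>2"
        using elim(1) by eventually_elim (simp add: power2_eq_square)
    qed simp_all
    then show ?case
      using A_norm_sq_eq[OF Ainf_spaceD(2)[OF a x]] inner[OF x] by (simp add: case_prod_unfold)
  qed
  have P_int: "has_bochner_integral \<nu> (\<lambda>x. P (z x) (\<eta> x)) (w * Ainf_norm_sq \<nu> M T a)"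
    using P \<eta> eq by (simp add: external_effect_condition_def)
  note N_int = Ainf_norm_sq_integrable[OF a]
  have "welfare \<nu> M T \<beta> P \<theta> h a z =
      (\<integral>x. A_inner M T (a x) (y x) - 1/2 * A_norm_sq M T (a x) + P (z x) (\<eta> x) \<partial>\<nu>)"
    by (simp add: welfare_def utility_def y_def \<eta>_def)
  also have "\<dots> = (\<integral>x. 1/2 * A_norm_sq M T (a x) + P (z x) (\<eta> x) \<partial>\<nu>)"
  proof (rule integral_cong_AE)
    show "AE x in \<nu>. A_inner M T (a x) (y x) - 1/2 * A_norm_sq M T (a x) + P (z x) (\<eta> x) =
        1/2 * A_norm_sq M T (a x) + P (z x) (\<eta> x)"
      using inner_ae by eventually_elim simp
  qed (use inner_meas P_int N_int in \<open>auto simp: has_bochner_integral_iff\<close>)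
  also have "\<dots> = 1/2 * Ainf_norm_sq \<nu> M T a + w * Ainf_norm_sq \<nu> M T a"
    using has_bochner_integral_add[OF has_bochner_integral_mult_right[OF N_int, of "1/2"] P_int]
    by (simp add: has_bochner_integral_iff)
  finally show ?thesis by (simp add: algebra_simps)
qed

section \<open>Spectral coefficients\<close>

text \<open>\<open>spectral_coeff\<close> for an arbitrary test function, uncurried so that it can
  be integrated over \<open>N\<close>.\<close>

definition coeff :: "(real \<Rightarrow> real) \<Rightarrow> (real \<Rightarrow> 'w process) \<Rightarrow> real \<times> 'w \<Rightarrow> real" where
  "coeff f a n = (\<integral>x. flat a (x, n) * f x \<partial>\<nu>)"

text \<open>Cauchy-Schwarz in \<open>x\<close> dominates the squared coefficient by a multiple of
  the squared norm of the section, which Fubini integrates over \<open>N\<close>.\<close>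

lemma square_integrable_coeff:
  assumes f: "square_integrable \<nu> f" and a: "square_integrable X (flat a)"
  shows "square_integrable N (coeff f a)"
proof -
  note [measurable] = square_integrable_measurable[OF f] square_integrable_measurable[OF a]
  have meas: "coeff f a \<in> borel_measurable N"
    unfolding coeff_def using square_integrable_measurable[OF f] square_integrable_measurable[OF a]
    by measurable
  have "integrable X (\<lambda>(x, n). (flat a (x, n))\<^sup>2)"
    using square_integrable_power2[OF a] by (simp add: case_prod_unfold)
  from X.integrable_snd[OF this]
  have "integrable N (\<lambda>n. (\<integral>x. (f x)\<^sup>2 \<partial>\<nu>) * (\<integral>x. (flat a (x, n))\<^sup>2 \<partial>\<nu>))"
    by simp
  then have "integrable N (\<lambda>n. (coeff f a n)\<^sup>2)"
  proof (rule Bochner_Integration.integrable_bound)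
    show "(\<lambda>n. (coeff f a n)\<^sup>2) \<in> borel_measurable N" using meas by measurable
    show "AE n in N. norm ((coeff f a n)\<^sup>2) \<le>
        norm ((\<integral>x. (f x)\<^sup>2 \<partial>\<nu>) * (\<integral>x. (flat a (x, n))\<^sup>2 \<partial>\<nu>))"
      using square_integrable_sections(2)[OF a]
    proof eventually_elim
      case (elim n)
      from integral_Cauchy_Schwarz[OF f elim] show ?case
        by (simp add: coeff_def mult.commute)
    qed
  qed
  with meas show ?thesis by (simp add: square_integrable_def)
qed

text \<open>The two orders of integration: one yields a pairing with the coefficient, the other an
  average of pairings with the members of the family. Equating them is the point.\<close>

lemma integral_mult_tensor:
  assumes f: "square_integrable \<nu> f" and a: "square_integrable X (flat a)"
    and \<psi>: "square_integrable N \<psi>"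
  shows "(\<integral>p. flat a p * (f (fst p) * \<psi> (snd p)) \<partial>X) = (\<integral>n. coeff f a n * \<psi> n \<partial>N)"
    and "(\<integral>p. flat a p * (f (fst p) * \<psi> (snd p)) \<partial>X) = (\<integral>x. f x * (\<integral>n. flat a (x, n) * \<psi> n \<partial>N) \<partial>\<nu>)"
proof -
  have int: "integrable X (\<lambda>(x, n). flat a (x, n) * (f x * \<psi> n))"
    using square_integrable_mult[OF a square_integrable_tensor[OF f \<psi>]]
    by (simp add: case_prod_unfold)
  have "(\<integral>n. (\<integral>x. flat a (x, n) * (f x * \<psi> n) \<partial>\<nu>) \<partial>N) = (\<integral>n. coeff f a n * \<psi> n \<partial>N)"
    by (simp only: coeff_def mult.assoc[symmetric] integral_mult_left_zero)
  with X.integral_snd[OF int]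
  show "(\<integral>p. flat a p * (f (fst p) * \<psi> (snd p)) \<partial>X) = (\<integral>n. coeff f a n * \<psi> n \<partial>N)"
    by (simp add: case_prod_unfold)
  have "(\<integral>x. (\<integral>n. flat a (x, n) * (f x * \<psi> n) \<partial>N) \<partial>\<nu>) = (\<integral>x. f x * (\<integral>n. flat a (x, n) * \<psi> n \<partial>N) \<partial>\<nu>)"
    by (simp only: mult.left_commute[of _ "f _"] integral_mult_right_zero)
  with X.integral_fst'[OF int]
  show "(\<integral>p. flat a p * (f (fst p) * \<psi> (snd p)) \<partial>X) = (\<integral>x. f x * (\<integral>n. flat a (x, n) * \<psi> n \<partial>N) \<partial>\<nu>)"
    by (simp add: case_prod_unfold)
qed

text \<open>
  A coefficient need not be progressively measurable, so it cannot be tested against itself;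
  testing against the members of the family suffices because the coefficient is an average of them.
\<close>
lemma coeff_eq_0:
  assumes f: "square_integrable \<nu> f" and a: "square_integrable X (flat a)"
    and orth: "\<And>x. x \<in> {0..1} \<Longrightarrow> (\<integral>n. coeff f a n * flat a (x, n) \<partial>N) = 0"
  shows "AE n in N. coeff f a n = 0"
proof -
  note q = square_integrable_coeff[OF f a]
  \<comment> \<open>Fubini only asks for square integrability of the test function, so here the
    coefficient may serve as its own test function; the inner integrals over \<open>N\<close> are
    then those of \<open>orth\<close>.\<close>
  have "(\<integral>n. (coeff f a n)\<^sup>2 \<partial>N) = (\<integral>x. f x * (\<integral>n. flat a (x, n) * coeff f a n \<partial>N) \<partial>\<nu>)"
    using integral_mult_tensor[OF f a q] by (simp add: power2_eq_square)
  also have "\<dots> = (\<integral>x. 0 \<partial>\<nu>)"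
    using orth by (intro Bochner_Integration.integral_cong refl) (simp add: mult.commute)
  finally show ?thesis
    using AE_eq_0_if_integral_power2_eq_0[OF q] by simp
qed

lemma coeff_add_scaled:
  assumes f: "square_integrable \<nu> f"
    and a: "square_integrable X (flat a)" and b: "square_integrable X (flat b)"
  shows "AE n in N. coeff f (\<lambda>x t \<omega>. a x t \<omega> + c * b x t \<omega>) n = coeff f a n + c * coeff f b n"
  using square_integrable_sections(2)[OF a] square_integrable_sections(2)[OF b]
proof eventually_elim
  case (elim n)
  have eq: "flat (\<lambda>x t \<omega>. a x t \<omega> + c * b x t \<omega>) (x, n) * f x =
      flat a (x, n) * f x + c * (flat b (x, n) * f x)" for x
    by (simp add: algebra_simps case_prod_unfold)
  show ?case
    using square_integrable_mult[OF elim(1) f] square_integrable_mult[OF elim(2) f]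
    unfolding coeff_def eq by simp
qed

text \<open>Self-adjointness moves the operator onto the eigenfunction, which diagonalises the
  equilibrium equation even for families outside the span of the basis.\<close>

lemma coeff_equilibrium:
  assumes eq: "equilibrium \<nu> M F T \<beta> W \<eta> a z" and \<eta>: "square_integrable X (flat \<eta>)"
    and f: "f \<in> eigenspace W \<kappa>"
  shows "AE n in N. coeff f \<eta> n = (1 - \<beta> * \<kappa>) * coeff f a n"
proof -
  note sf = eigenspace_square_integrable[OF f]
  note a = Ainf_spaceD(1)[OF equilibriumD(1)[OF eq]]
  show ?thesis
    using AE_X_snd[OF equilibriumD(3)[OF eq]]
      square_integrable_sections(2)[OF a] square_integrable_sections(2)[OF \<eta>]
  proof eventually_elim
    case (elim n)
    obtain t \<omega> where n: "n = (t, \<omega>)" by (cases n)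
    define g where "g = (\<lambda>x. flat a (x, n))"
    have g: "square_integrable \<nu> g" using elim(2) by (simp add: g_def)
    have op: "graphon_op_process \<nu> W a x t \<omega> = graphon_op \<nu> W g x" for x
      by (simp add: graphon_op_process_def g_def n)
    note [measurable] = square_integrable_measurable[OF sf] square_integrable_measurable[OF g]
      square_integrable_measurable[OF elim(3)]
    note int = square_integrable_mult[OF g sf] graphon_op_adjoint(1)[OF sf g]
    have "coeff f \<eta> n = (\<integral>x. g x * f x - \<beta> * (graphon_op \<nu> W g x * f x) \<partial>\<nu>)"
      unfolding coeff_def
    proof (rule integral_cong_AE)
      show "AE x in \<nu>. flat \<eta> (x, n) * f x = g x * f x - \<beta> * (graphon_op \<nu> W g x * f x)"
        using elim(1) by eventually_elim (simp add: n op g_def algebra_simps)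
      show "(\<lambda>x. g x * f x - \<beta> * (graphon_op \<nu> W g x * f x)) \<in> borel_measurable \<nu>"
        using int by (intro borel_measurable_integrable) auto
    qed measurable
    also have "\<dots> = (\<integral>x. g x * f x \<partial>\<nu>) - \<beta> * (\<kappa> * (\<integral>x. g x * f x \<partial>\<nu>))"
      using int graphon_op_inner_eigenfunction[OF f g] by simp
    finally show ?case by (simp add: coeff_def g_def algebra_simps)
  qed
qed

section \<open>The eigenbasis\<close>

lemma spectral_index_eigen:
  assumes "orthonormal_eigenbasis W e" "(\<kappa>, j) \<in> spectral_index W"
  shows "e \<kappa> j \<in> eigenspace W \<kappa>"
  using assms by (auto simp: orthonormal_eigenbasis_def)

lemma spectral_index_orthonormal:
  assumes e: "orthonormal_eigenbasis W e" and i: "(\<kappa>, j) \<in> spectral_index W" "(\<kappa>', j') \<in> spectral_index W"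
  shows "(\<integral>x. e \<kappa> j x * e \<kappa>' j' x \<partial>\<nu>) = (if (\<kappa>, j) = (\<kappa>', j') then 1 else 0)"
proof -
  have "e \<kappa> j \<in> L2 Leb01" "e \<kappa>' j' \<in> L2 Leb01"
    using spectral_index_eigen[OF e] i by (auto simp: eigenspace_def)
  note inner = L2_inner_Leb01[OF this]
  have "\<forall>(\<kappa>, j)\<in>spectral_index W. \<forall>(\<kappa>', j')\<in>spectral_index W.
      L2_inner Leb01 (e \<kappa> j) (e \<kappa>' j') = (if (\<kappa>, j) = (\<kappa>', j') then 1 else 0)"
    using e unfolding orthonormal_eigenbasis_def by (elim conjE)
  from bspec[OF bspec[OF this i(1), unfolded prod.case] i(2), unfolded prod.case]
  show ?thesis unfolding inner .
qed

section \<open>Bounds on the eigenvalues\<close>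

lemma eigenfunction_bound:
  assumes f: "f \<in> eigenspace W \<kappa>"
  shows "\<kappa>\<^sup>2 * (\<integral>x. (f x)\<^sup>2 \<partial>\<nu>) \<le> (\<integral>x. (f x)\<^sup>2 \<partial>\<nu>)"
proof -
  note sf = eigenspace_square_integrable[OF f]
  have "(\<integral>x. \<kappa>\<^sup>2 * (f x)\<^sup>2 \<partial>\<nu>) \<le> (\<integral>x. (\<integral>y. (f y)\<^sup>2 \<partial>\<nu>) \<partial>\<nu>)"
  proof (rule integral_mono_AE)
    show "AE x in \<nu>. \<kappa>\<^sup>2 * (f x)\<^sup>2 \<le> (\<integral>y. (f y)\<^sup>2 \<partial>\<nu>)"
      using graphon_op_eigenfunction[OF f] AE_space
    proof eventually_elim
      case (elim x)
      then have x: "x \<in> {0..1}" by simp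
      have "\<kappa>\<^sup>2 * (f x)\<^sup>2 = (\<integral>y. W x y * f y \<partial>\<nu>)\<^sup>2"
        using elim(1) by (simp add: graphon_op_def power_mult_distrib)
      also have "\<dots> \<le> (\<integral>y. (W x y)\<^sup>2 \<partial>\<nu>) * (\<integral>y. (f y)\<^sup>2 \<partial>\<nu>)"
        by (rule integral_Cauchy_Schwarz[OF W_section[OF x] sf])
      also have "\<dots> \<le> 1 * (\<integral>y. (f y)\<^sup>2 \<partial>\<nu>)"
        using W_section_norm_le[OF x] by (intro mult_right_mono) auto
      finally show ?case by simp
    qed
  qed (use square_integrable_power2[OF sf] in auto)
  then show ?thesis using nu.prob_space by simp
qed

text \<open>Boundedness is what makes the supremum in \<open>largest_eigenvalue\<close> an upper
  bound of the eigenvalues.\<close>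

lemma eigenvalue_le_1:
  assumes "\<kappa> \<in> eigenvalues W"
  shows "\<kappa> \<le> 1"
proof -
  obtain f where f: "f \<in> eigenspace W \<kappa>" and ne: "\<not> (AE x in Leb01. f x = 0)"
    using assms by (auto simp: eigenvalues_def)
  have L2: "f \<in> L2 Leb01" using f by (simp add: eigenspace_def)
  \<comment> \<open>\<open>AE_Leb01D\<close> leads only from \<open>Leb01\<close> to \<nu>, so the
    norm is shown to be nonzero over \<open>Leb01\<close> and then transferred as an
    integral.\<close>
  then have "square_integrable Leb01 f" by (simp add: L2_def square_integrable_def)
  with ne have "(\<integral>x. (f x)\<^sup>2 \<partial>Leb01) \<noteq> 0"
    using AE_eq_0_if_integral_power2_eq_0 by blast
  moreover have "(\<integral>x. (f x)\<^sup>2 \<partial>Leb01) = (\<integral>x. (f x)\<^sup>2 \<partial>\<nu>)"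
    using L2 by (intro integral_Leb01) (auto simp: L2_def)
  ultimately have "0 < (\<integral>x. (f x)\<^sup>2 \<partial>\<nu>)" by (simp add: less_le)
  with eigenfunction_bound[OF f] have "\<kappa>\<^sup>2 \<le> 1" by simp
  then show ?thesis using abs_square_le_1 abs_le_D1 by blast
qed

lemma spectral_index_le_largest_eigenvalue:
  assumes e: "orthonormal_eigenbasis W e" and i: "(\<kappa>, j) \<in> spectral_index W"
  shows "\<kappa> \<le> largest_eigenvalue W"
proof -
  have "\<not> (AE x in Leb01. e \<kappa> j x = 0)"
  proof
    assume "AE x in Leb01. e \<kappa> j x = 0"
    from AE_Leb01D[OF this] have "AE x in \<nu>. e \<kappa> j x * e \<kappa> j x = 0"
      by eventually_elim simp
    then have "(\<integral>x. e \<kappa> j x * e \<kappa> j x \<partial>\<nu>) = 0" by (rule integral_eq_zero_AE)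
    with spectral_index_orthonormal[OF e i i] show False by simp
  qed
  then have "\<kappa> \<in> eigenvalues W"
    using spectral_index_eigen[OF e i] by (auto simp: eigenvalues_def)
  moreover have "bdd_above (eigenvalues W)" using eigenvalue_le_1 by (rule bdd_aboveI)
  ultimately show ?thesis by (simp add: largest_eigenvalue_def cSup_upper)
qed

text \<open>
  Bessel's inequality for the sections \<open>W x\<close>, integrated over \<open>x\<close>, bounds the sum of the squared
  eigenvalues by the Hilbert-Schmidt norm of the kernel.
\<close>
lemma sum_power2_eigenvalues_le_1:
  assumes e: "orthonormal_eigenbasis W e" and K: "finite K" "(\<lambda>\<kappa>. (\<kappa>, 1)) ` K \<subseteq> spectral_index W"
  shows "(\<Sum>\<kappa>\<in>K. \<kappa>\<^sup>2) \<le> 1"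
proof -
  have idx: "(\<kappa>, 1) \<in> spectral_index W" if "\<kappa> \<in> K" for \<kappa> using K(2) that by auto
  note eig = spectral_index_eigen[OF e idx]
  note sq = eigenspace_square_integrable[OF eig]
  have one: "(\<integral>x. (e \<kappa> 1 x)\<^sup>2 \<partial>\<nu>) = 1" if "\<kappa> \<in> K" for \<kappa>
    using spectral_index_orthonormal[OF e idx idx, OF that that] by (simp add: power2_eq_square)
  have int: "integrable \<nu> (\<lambda>x. \<kappa>\<^sup>2 * (e \<kappa> 1 x)\<^sup>2)" if "\<kappa> \<in> K" for \<kappa>
    using square_integrable_power2[OF sq[OF that]] by simp
  have "(\<Sum>\<kappa>\<in>K. \<kappa>\<^sup>2) = (\<integral>x. (\<Sum>\<kappa>\<in>K. \<kappa>\<^sup>2 * (e \<kappa> 1 x)\<^sup>2) \<partial>\<nu>)"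
    using one by (subst Bochner_Integration.integral_sum[OF int]) (auto simp del: One_nat_def)
  also have "\<dots> \<le> (\<integral>x. 1 \<partial>\<nu>)"
  proof (rule integral_mono_AE)
    have "AE x in \<nu>. \<forall>\<kappa>\<in>K. graphon_op \<nu> W (e \<kappa> 1) x = \<kappa> * e \<kappa> 1 x"
      using K(1) graphon_op_eigenfunction[OF eig] by (intro AE_finite_allI) auto
    then show "AE x in \<nu>. (\<Sum>\<kappa>\<in>K. \<kappa>\<^sup>2 * (e \<kappa> 1 x)\<^sup>2) \<le> 1"
      using AE_space[of \<nu>]
    proof eventually_elim
      case (elim x)
      then have x: "x \<in> {0..1}" by simp
      have "(\<Sum>\<kappa>\<in>K. \<kappa>\<^sup>2 * (e \<kappa> 1 x)\<^sup>2) = (\<Sum>\<kappa>\<in>K. (\<integral>y. W x y * e \<kappa> 1 y \<partial>\<nu>)\<^sup>2)"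
        using elim(1) by (intro sum.cong) (auto simp: graphon_op_def power_mult_distrib)
      also have "\<dots> \<le> (\<integral>y. (W x y)\<^sup>2 \<partial>\<nu>)"
        using spectral_index_orthonormal[OF e idx idx]
        by (intro Bessel_inequality K(1) W_section[OF x] sq) auto
      also note W_section_norm_le[OF x]
      finally show ?case .
    qed
  qed (use int in auto)
  finally show ?thesis using nu.prob_space by simp
qed

text \<open>A summable family has countably many nonzero terms; the eigenvalue 0 contributes one
  more. Countability later merges the almost-everywhere statements for the single eigenpairs into
  one.\<close>

lemma countable_spectral_index:
  assumes e: "orthonormal_eigenbasis W e"
  shows "countable (spectral_index W)"
proof -
  define K where "K = fst ` spectral_index W"
  have one: "(\<kappa>, 1) \<in> spectral_index W" if \<kappa>: "\<kappa> \<in> K" for \<kappa>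
  proof -
    obtain j where j: "\<kappa> \<in> graphon_spectrum W" "1 \<le> j" "enat j \<le> eigen_multiplicity W \<kappa>"
      using \<kappa> by (auto simp: K_def spectral_index_def)
    \<comment> \<open>Admissible indices \<open>j\<close> are closed downwards, so every eigenvalue
      in \<open>K\<close> is represented by \<open>j = 1\<close>.\<close>
    have "enat 1 \<le> enat j" using j(2) by simp
    also note j(3)
    finally show ?thesis using j(1) by (simp add: spectral_index_def)
  qed
  have "(\<lambda>\<kappa>. \<kappa>\<^sup>2) summable_on K"
  proof (rule nonneg_bdd_above_summable_on)
    show "bdd_above (sum (\<lambda>\<kappa>. \<kappa>\<^sup>2) ` {S. S \<subseteq> K \<and> finite S})"
      using one by (intro bdd_aboveI[of _ 1]) (force intro!: sum_power2_eigenvalues_le_1[OF e])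
  qed simp
  from summable_countable_real[OF this] have "countable {\<kappa> \<in> K. \<kappa>\<^sup>2 \<noteq> 0}" .
  then have "countable (insert 0 {\<kappa> \<in> K. \<kappa>\<^sup>2 \<noteq> 0})" by simp
  then have "countable K" by (rule countable_subset[rotated]) auto
  then have "countable (K \<times> (UNIV :: nat set))" by simp
  then show ?thesis by (rule countable_subset[rotated]) (force simp: K_def)
qed

text \<open>\<open>g\<close> itself need not be approximable by the basis, but \<open>W x\<close>
  is: up to a small error it is a finite combination of basis functions, all orthogonal to
  \<open>g\<close>.\<close>

lemma graphon_op_eq_0:
  assumes e: "orthonormal_eigenbasis W e" and g: "square_integrable \<nu> g"
    and orth: "\<And>\<kappa> j. (\<kappa>, j) \<in> spectral_index W \<Longrightarrow> (\<integral>y. g y * e \<kappa> j y \<partial>\<nu>) = 0"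
    and x: "x \<in> {0..1}"
  shows "graphon_op \<nu> W g x = 0"
proof (rule ccontr)
  let ?I = "graphon_op \<nu> W g x" and ?G = "\<integral>y. (g y)\<^sup>2 \<partial>\<nu>"
  assume ne: "?I \<noteq> 0"
  have G: "0 \<le> ?G" by simp
  \<comment> \<open>Cauchy-Schwarz will bound \<open>?I\<^sup>2\<close> by
    \<open>\<delta>\<^sup>2 * ?G\<close>, which this choice makes strictly smaller than
    \<open>?I\<^sup>2\<close>; the summand 1 covers \<open>?G = 0\<close>.\<close>
  define \<delta> where "\<delta> = \<bar>?I\<bar> / sqrt (?G + 1)"
  have "0 < ?G + 1" using G by linarith
  with ne have "\<delta> > 0" by (simp add: \<delta>_def del: integral_nonneg_AE)
  then obtain S c where S: "finite S" "S \<subseteq> spectral_index W"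
    and approx: "L2_norm Leb01 (\<lambda>y. W x y - (\<Sum>(\<kappa>, j)\<in>S. c (\<kappa>, j) * e \<kappa> j y)) < \<delta>"
    using e W_section_L2[OF x] unfolding orthonormal_eigenbasis_def by blast
  define s where "s y = (\<Sum>i\<in>S. c i * e (fst i) (snd i) y)" for y
  define r where "r y = W x y + (-1) * s y" for y
  have eL2: "e (fst i) (snd i) \<in> L2 Leb01" if "i \<in> S" for i
    using spectral_index_eigen[OF e, of "fst i" "snd i"] S(2) that by (auto simp: eigenspace_def)
  note se = L2_square_integrable[OF eL2]
  have s: "square_integrable \<nu> s" unfolding s_def by (rule square_integrable_sum[OF se])
  have r: "square_integrable \<nu> r" unfolding r_def by (rule square_integrable_add_scaled[OF W_section[OF x] s])
  have "r \<in> borel_measurable Leb01"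
  proof -
    have [measurable]: "s \<in> borel_measurable Leb01"
      unfolding s_def using eL2 by (intro borel_measurable_sum borel_measurable_times) (auto simp: L2_def)
    note [measurable] = W_section_measurable[OF x]
    show ?thesis unfolding r_def by measurable
  qed
  then have "(\<lambda>y. r y * r y) \<in> borel_measurable Leb01" by measurable
  from integral_Leb01[OF this] have norm_r: "L2_norm Leb01 r = sqrt (\<integral>y. (r y)\<^sup>2 \<partial>\<nu>)"
    by (simp add: L2_norm_def L2_inner_def power2_eq_square)
  have "r = (\<lambda>y. W x y - (\<Sum>(\<kappa>, j)\<in>S. c (\<kappa>, j) * e \<kappa> j y))"
    by (simp add: fun_eq_iff r_def s_def case_prod_unfold)
  with approx norm_r have "sqrt (\<integral>y. (r y)\<^sup>2 \<partial>\<nu>) < \<delta>" by simp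
  then have "(\<integral>y. (r y)\<^sup>2 \<partial>\<nu>) \<le> \<delta>\<^sup>2"
    using \<open>\<delta> > 0\<close> by (metis less_imp_le sqrt_le_D)
  have "(\<integral>y. g y * s y \<partial>\<nu>) = (\<integral>y. (\<Sum>i\<in>S. c i * (g y * e (fst i) (snd i) y)) \<partial>\<nu>)"
    by (simp add: s_def sum_distrib_left ac_simps)
  also have "\<dots> = (\<Sum>i\<in>S. c i * (\<integral>y. g y * e (fst i) (snd i) y \<partial>\<nu>))"
    using square_integrable_mult[OF g se] by (subst Bochner_Integration.integral_sum) auto
  also have "\<dots> = 0"
    using S(2) orth by (intro sum.neutral) auto
  finally have gs: "(\<integral>y. g y * s y \<partial>\<nu>) = 0" .
  have Wxy: "W x y * g y = r y * g y + g y * s y" for y by (simp add: r_def algebra_simps)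
  have "?I = (\<integral>y. r y * g y \<partial>\<nu>)"
    unfolding graphon_op_def Wxy
    using square_integrable_mult[OF r g] square_integrable_mult[OF g s] gs by simp
  then have "?I\<^sup>2 \<le> (\<integral>y. (r y)\<^sup>2 \<partial>\<nu>) * ?G"
    using integral_Cauchy_Schwarz[OF r g] by simp
  also have "\<dots> \<le> \<delta>\<^sup>2 * ?G"
    using \<open>(\<integral>y. (r y)\<^sup>2 \<partial>\<nu>) \<le> \<delta>\<^sup>2\<close> G by (rule mult_right_mono)
  also have "\<dots> = ?I\<^sup>2 * (?G / (?G + 1))"
    using G by (simp add: \<delta>_def power_divide)
  also have "\<dots> < ?I\<^sup>2 * 1"
    using ne \<open>0 < ?G + 1\<close> by (intro mult_strict_left_mono) (simp_all add: divide_less_eq_1_pos)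
  finally show False by simp
qed

end

section \<open>First-order conditions at an optimal intervention\<close>

text \<open>The objective enters only in its reduced form, \<open>k\<close> times the squared norm
  of the action; \<open>welfare_eq\<close> provides it with \<open>k = 1/2 + w\<close>.\<close>

locale intervention = graphon_setting M \<nu> T W
  for M :: "'w measure" and \<nu> T W +
  fixes F :: "real \<Rightarrow> 'w measure" and \<beta> C k :: real
    and e :: "real \<Rightarrow> nat \<Rightarrow> real \<Rightarrow> real"
    and \<theta> \<theta>bar abar zbar :: "real \<Rightarrow> 'w process"
  assumes T: "T > 0" and C: "C > 0" and k: "k \<noteq> 0"
    and basis: "orthonormal_eigenbasis W e"
    and gap: "\<And>\<kappa> j. (\<kappa>, j) \<in> spectral_index W \<Longrightarrow> \<beta> * \<kappa> < 1"
    and theta: "\<theta> \<in> Ainf_space \<nu> M F T"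
    and theta_coeff: "\<And>\<kappa> j. (\<kappa>, j) \<in> spectral_index W \<Longrightarrow> AE n in N. coeff (e \<kappa> j) \<theta> n \<noteq> 0"
    and large: "k < 0 \<Longrightarrow> C < Ainf_norm_sq \<nu> M T \<theta>"
    and feas: "feasible \<nu> M F T \<beta> W C \<theta> \<theta>bar abar zbar"
    and opt: "\<And>h a z. feasible \<nu> M F T \<beta> W C \<theta> h a z \<Longrightarrow>
      k * Ainf_norm_sq \<nu> M T a \<le> k * Ainf_norm_sq \<nu> M T abar"
begin

definition inner :: "(real \<Rightarrow> 'w process) \<Rightarrow> (real \<Rightarrow> 'w process) \<Rightarrow> real" where
  "inner a b = (\<integral>p. flat a p * flat b p \<partial>X)"

definition target :: "real \<Rightarrow> 'w process" where
  "target = (\<lambda>x t \<omega>. \<theta> x t \<omega> + \<theta>bar x t \<omega>)"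

text \<open>
  The directions in which the intervention can be varied, together with the induced change of the
  equilibrium; \<open>(I - \<beta> W)\<^sup>-\<^sup>1\<close> is never needed on all of the space.
\<close>
definition variation :: "(real \<Rightarrow> 'w process) \<Rightarrow> (real \<Rightarrow> 'w process) \<Rightarrow> bool" where
  "variation h b \<longleftrightarrow> h \<in> Ainf_space \<nu> M F T \<and> (\<exists>z. equilibrium \<nu> M F T \<beta> W h b z)"

lemma thetabar: "\<theta>bar \<in> Ainf_space \<nu> M F T"
  and equilibrium_abar: "equilibrium \<nu> M F T \<beta> W target abar zbar"
  and norm_thetabar: "Ainf_norm_sq \<nu> M T \<theta>bar \<le> C"
  using feas by (auto simp: feasible_def target_def)

lemma target: "target \<in> Ainf_space \<nu> M F T"
  using Ainf_space_add_scaled[OF theta thetabar, of 1] by (simp add: target_def)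

lemmas abar = equilibriumD(1)[OF equilibrium_abar]

lemma variation_target: "variation target abar"
  using target equilibrium_abar by (auto simp: variation_def)

lemma variation_Ainf:
  assumes "variation h b"
  shows "h \<in> Ainf_space \<nu> M F T" "b \<in> Ainf_space \<nu> M F T"
  using assms by (auto simp: variation_def dest: equilibriumD)

lemma variation_add_scaled:
  assumes "variation h b" "variation h' b'"
  shows "variation (\<lambda>x t \<omega>. h x t \<omega> + c * h' x t \<omega>) (\<lambda>x t \<omega>. b x t \<omega> + c * b' x t \<omega>)"
  using assms by (auto simp: variation_def intro: Ainf_space_add_scaled equilibrium_add_scaled)

lemma variation_tensor:
  assumes f: "f \<in> eigenspace W \<kappa>"
    and \<psi>: "progressively_measurable F T \<psi>" "square_integrable N (\<lambda>(t, \<omega>). \<psi> t \<omega>)"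
  shows "variation (\<lambda>x t \<omega>. ((1 - \<beta> * \<kappa>) * f x) * \<psi> t \<omega>) (\<lambda>x t \<omega>. f x * \<psi> t \<omega>)"
  using Ainf_space_tensor[OF square_integrable_scaled[OF eigenspace_square_integrable[OF f]] \<psi>]
    equilibrium_tensor[OF f \<psi>] by (auto simp: variation_def)

lemma inner_add_scaled:
  assumes "a \<in> Ainf_space \<nu> M F T" "b \<in> Ainf_space \<nu> M F T" "b' \<in> Ainf_space \<nu> M F T"
  shows "inner a (\<lambda>x t \<omega>. b x t \<omega> + c * b' x t \<omega>) = inner a b + c * inner a b'"
proof -
  note sq = assms[THEN Ainf_spaceD(1)]
  have eq: "flat a p * flat (\<lambda>x t \<omega>. b x t \<omega> + c * b' x t \<omega>) p =
      flat a p * flat b p + c * (flat a p * flat b' p)" for p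
    by (simp add: case_prod_unfold algebra_simps)
  show ?thesis
    using square_integrable_mult[OF sq(1) sq(2)] square_integrable_mult[OF sq(1) sq(3)]
    unfolding inner_def eq by simp
qed

lemma inner_self: "a \<in> Ainf_space \<nu> M F T \<Longrightarrow> inner a a = Ainf_norm_sq \<nu> M T a"
  by (simp add: inner_def Ainf_norm_sq_eq power2_eq_square)

lemma inner_tensor:
  assumes a: "a \<in> Ainf_space \<nu> M F T" and f: "square_integrable \<nu> f"
    and \<psi>: "square_integrable N (\<lambda>(t, \<omega>). \<psi> t \<omega>)"
  shows "inner a (\<lambda>x t \<omega>. (c * f x) * \<psi> t \<omega>) = c * (\<integral>n. coeff f a n * (case n of (t, \<omega>) \<Rightarrow> \<psi> t \<omega>) \<partial>N)"
proof -
  have "inner a (\<lambda>x t \<omega>. (c * f x) * \<psi> t \<omega>) =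
      (\<integral>p. c * (flat a p * (f (fst p) * (\<lambda>(t, \<omega>). \<psi> t \<omega>) (snd p))) \<partial>X)"
    unfolding inner_def by (intro Bochner_Integration.integral_cong refl) (simp add: case_prod_unfold)
  then show ?thesis
    using integral_mult_tensor(1)[OF f Ainf_spaceD(1)[OF a] \<psi>] by simp
qed

text \<open>Budget and objective are quadratic and equilibria are linear, so the expansion along a
  variation is exact. It may therefore be used for finite steps as well as infinitesimal
  ones.\<close>

lemma variation_quadratic:
  assumes v: "variation h b"
    and le: "Ainf_norm_sq \<nu> M T \<theta>bar + 2 * \<epsilon> * inner \<theta>bar h + \<epsilon>\<^sup>2 * Ainf_norm_sq \<nu> M T h \<le> C"
  shows "2 * \<epsilon> * (k * inner abar b) + \<epsilon>\<^sup>2 * (k * Ainf_norm_sq \<nu> M T b) \<le> 0"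
proof -
  note hb = variation_Ainf[OF v]
  obtain z where z: "equilibrium \<nu> M F T \<beta> W h b z" using v by (auto simp: variation_def)
  have "feasible \<nu> M F T \<beta> W C \<theta> (\<lambda>x t \<omega>. \<theta>bar x t \<omega> + \<epsilon> * h x t \<omega>)
      (\<lambda>x t \<omega>. abar x t \<omega> + \<epsilon> * b x t \<omega>) (\<lambda>x t \<omega>. zbar x t \<omega> + \<epsilon> * z x t \<omega>)"
    using equilibrium_add_scaled[OF equilibrium_abar z, of \<epsilon>] le
      Ainf_space_add_scaled[OF thetabar hb(1)] Ainf_norm_sq_add_scaled[OF thetabar hb(1), of \<epsilon>]
    by (simp add: feasible_def target_def inner_def add.assoc)
  from opt[OF this] show ?thesis
    unfolding Ainf_norm_sq_add_scaled[OF abar hb(2)] by (simp add: inner_def algebra_simps)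
qed

lemma variation_first_order:
  assumes v: "variation h b" and "inner \<theta>bar h < 0 \<or> Ainf_norm_sq \<nu> M T \<theta>bar < C"
  shows "k * inner abar b \<le> 0"
  by (rule first_order_quadratic[OF variation_quadratic[OF v] norm_thetabar assms(2)])

text \<open>The variations used have the members of \<open>\<theta>bar\<close> itself as amplitudes;
  \<open>gap\<close> cancels the factor \<open>1 - \<beta> * \<kappa>\<close>.\<close>

lemma coeff_thetabar_eq_0:
  assumes zero: "\<And>h b. variation h b \<Longrightarrow> inner \<theta>bar h = 0" and i: "(\<kappa>, j) \<in> spectral_index W"
  shows "AE n in N. coeff (e \<kappa> j) \<theta>bar n = 0"
proof (rule coeff_eq_0)
  note f = spectral_index_eigen[OF basis i]
  show sf: "square_integrable \<nu> (e \<kappa> j)" by (rule eigenspace_square_integrable[OF f])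
  show "square_integrable X (flat \<theta>bar)" by (rule Ainf_spaceD[OF thetabar])
  fix x :: real assume x: "x \<in> {0..1}"
  note \<psi> = Ainf_spaceD(3,2)[OF thetabar x]
  have "(1 - \<beta> * \<kappa>) * (\<integral>n. coeff (e \<kappa> j) \<theta>bar n * (case n of (t, \<omega>) \<Rightarrow> \<theta>bar x t \<omega>) \<partial>N) = 0"
    using zero[OF variation_tensor[OF f \<psi>]] inner_tensor[OF thetabar sf \<psi>(2)] by simp
  then show "(\<integral>n. coeff (e \<kappa> j) \<theta>bar n * flat \<theta>bar (x, n) \<partial>N) = 0"
    using gap[OF i] by simp
qed

text \<open>If \<open>\<theta>bar\<close> were orthogonal to every variation, it would lie in the kernel of \<open>W\<close> and so be one itself.\<close>
lemma exists_variation_nonzero: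
  assumes bind: "Ainf_norm_sq \<nu> M T \<theta>bar = C"
  obtains h b where "variation h b" "inner \<theta>bar h \<noteq> 0"
proof (rule ccontr)
  assume "\<not> thesis"
  with that have zero: "\<And>h b. variation h b \<Longrightarrow> inner \<theta>bar h = 0" by blast
  \<comment> \<open>\<open>graphon_op_eq_0\<close> needs all coefficients to vanish at the same
    \<open>n\<close>, which is where countability enters.\<close>
  have "AE n in N. \<forall>i\<in>spectral_index W. coeff (e (fst i) (snd i)) \<theta>bar n = 0"
    using countable_spectral_index[OF basis] coeff_thetabar_eq_0[OF zero]
    by (subst AE_ball_countable) auto
  then have "AE n in N. \<forall>x\<in>{0..1}. case (x, n) of (x, t, \<omega>) \<Rightarrow> graphon_op_process \<nu> W \<theta>bar x t \<omega> = 0"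
    using square_integrable_sections(2)[OF Ainf_spaceD(1)[OF thetabar]]
  proof eventually_elim
    case (elim n)
    have "graphon_op \<nu> W (\<lambda>x. flat \<theta>bar (x, n)) x = 0" if "x \<in> {0..1}" for x
      using elim(1) by (intro graphon_op_eq_0[OF basis elim(2) _ that]) (force simp: coeff_def)
    then show ?case by (auto simp: graphon_op_process_def)
  qed
  from AE_X_sndI[OF this]
  have ker: "AE (x, t, \<omega>) in X. graphon_op_process \<nu> W \<theta>bar x t \<omega> = 0" .
  have "equilibrium \<nu> M F T \<beta> W \<theta>bar \<theta>bar (\<lambda>x t \<omega>. 0)"
    unfolding equilibrium_def Ainf_eq_def
  proof (intro conjI)
    show "AE (x, t, \<omega>) in X. \<theta>bar x t \<omega> - \<beta> * graphon_op_process \<nu> W \<theta>bar x t \<omega> = \<theta>bar x t \<omega>"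
      using ker by eventually_elim auto
    show "AE (x, t, \<omega>) in X. 0 = graphon_op_process \<nu> W \<theta>bar x t \<omega>"
      using ker by eventually_elim auto
  qed (auto intro: thetabar Ainf_space_zero)
  then have "variation \<theta>bar \<theta>bar" using thetabar by (auto simp: variation_def)
  from zero[OF this] inner_self[OF thetabar] bind C show False by simp
qed

text \<open>With a slack budget every first variation of the objective vanishes and the multiplier
  is 0. With a binding one the pairs of first variations satisfy the hypotheses of
  \<open>multiplier_exists\<close>.\<close>

lemma lagrange_multiplier:
  obtains \<mu> where "\<mu> \<ge> 0" "\<And>h b. variation h b \<Longrightarrow> k * inner abar b = \<mu> * inner \<theta>bar h"
proof -
  note goal = that
  define V where "V = {(inner \<theta>bar h, k * inner abar b) | h b. variation h b}"
  have lin: "(x + c * x', y + c * y') \<in> V" if xy: "(x, y) \<in> V" "(x', y') \<in> V" for x y x' y' c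
  proof -
    obtain h b h' b' where v: "variation h b" "variation h' b'"
      and eq: "x = inner \<theta>bar h" "y = k * inner abar b" "x' = inner \<theta>bar h'" "y' = k * inner abar b'"
      using xy by (auto simp: V_def)
    note vv = variation_add_scaled[OF v, of c]
    have "x + c * x' = inner \<theta>bar (\<lambda>x t \<omega>. h x t \<omega> + c * h' x t \<omega>)"
      using inner_add_scaled[OF thetabar variation_Ainf(1)[OF v(1)] variation_Ainf(1)[OF v(2)]] eq by simp
    moreover have "y + c * y' = k * inner abar (\<lambda>x t \<omega>. b x t \<omega> + c * b' x t \<omega>)"
      using inner_add_scaled[OF abar variation_Ainf(2)[OF v(1)] variation_Ainf(2)[OF v(2)]] eq
      by (simp add: algebra_simps)
    ultimately show ?thesis using vv by (auto simp: V_def)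
  qed
  have *: thesis if "\<mu> \<ge> 0" and V: "\<And>x y. (x, y) \<in> V \<Longrightarrow> y = \<mu> * x" for \<mu>
    using \<open>\<mu> \<ge> 0\<close> by (rule goal) (rule V, auto simp: V_def)
  show thesis
  proof (cases "Ainf_norm_sq \<nu> M T \<theta>bar < C")
    case True
    have le: "y \<le> 0" if "(x, y) \<in> V" for x y
      using that variation_first_order True by (auto simp: V_def)
    \<comment> \<open>Adding -2 times a pair to itself negates it, so the inequality holds in both
      directions.\<close>
    have "y = 0" if "(x, y) \<in> V" for x y
      using le[OF that] le[OF lin[OF that that, of "-2"]] by simp
    then show thesis using *[of 0] by auto
  next
    case False
    then have "Ainf_norm_sq \<nu> M T \<theta>bar = C" using norm_thetabar by simp
    from exists_variation_nonzero[OF this] obtain h0 b0 where "variation h0 b0" "inner \<theta>bar h0 \<noteq> 0" .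
    then have ne: "(inner \<theta>bar h0, k * inner abar b0) \<in> V" "inner \<theta>bar h0 \<noteq> 0" by (auto simp: V_def)
    have sign: "y \<le> 0" if "(x, y) \<in> V" "x < 0" for x y
      using that variation_first_order by (auto simp: V_def)
    show thesis by (rule multiplier_exists[OF lin sign ne]) (use * in blast)+
  qed
qed

text \<open>Since \<open>T > 0\<close>, the space \<open>N\<close> has positive mass, so
  contradictory almost-everywhere statements can be refuted.\<close>

lemma AE_N_False: "\<not> (AE n in N. False)"
proof
  assume "AE n in N. False"
  then have "emeasure N (space N) = 0"
    using AE_iff_measurable[of "space N" N "\<lambda>_. False"] by simp
  moreover have "emeasure N (space N) = emeasure (time_measure T) (space (time_measure T)) * emeasure M (space M)"
    unfolding space_pair_measure by (rule emeasure_pair_measure_Times[OF sets.top sets.top])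
  then have "emeasure N (space N) = ennreal T"
    using T by (simp add: emeasure_space_1 emeasure_restrict_space space_restrict_space)
  ultimately show False using T by simp
qed

section \<open>Stationarity at a single eigenpair\<close>

context
  fixes \<mu> \<kappa> :: real and j :: nat
  assumes \<mu>: "\<And>h b. variation h b \<Longrightarrow> k * inner abar b = \<mu> * inner \<theta>bar h"
    and i: "(\<kappa>, j) \<in> spectral_index W"
begin

private definition "f = e \<kappa> j"
private definition "d = 1 - \<beta> * \<kappa>"

private lemma f: "f \<in> eigenspace W \<kappa>"
  unfolding f_def by (rule spectral_index_eigen[OF basis i])

private lemmas sf = eigenspace_square_integrable[OF f]

private lemma d: "d > 0" using gap[OF i] by (simp add: d_def)

private lemma first_order_tested:
  assumes \<psi>: "progressively_measurable F T \<psi>" "square_integrable N (\<lambda>(t, \<omega>). \<psi> t \<omega>)"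
  shows "k * (\<integral>n. coeff f abar n * (case n of (t, \<omega>) \<Rightarrow> \<psi> t \<omega>) \<partial>N) =
    \<mu> * (d * (\<integral>n. coeff f \<theta>bar n * (case n of (t, \<omega>) \<Rightarrow> \<psi> t \<omega>) \<partial>N))"
  using \<mu>[OF variation_tensor[OF f \<psi>]] inner_tensor[OF thetabar sf \<psi>(2), of d]
    inner_tensor[OF abar sf \<psi>(2), of 1] by (simp add: d_def)

private lemma coeff_target: "AE n in N. coeff f target n = coeff f \<theta> n + coeff f \<theta>bar n"
  using coeff_add_scaled[OF sf Ainf_spaceD(1)[OF theta] Ainf_spaceD(1)[OF thetabar], of 1]
  by (simp add: target_def)

lemma first_order_coeff:
  "AE n in N. k * (coeff (e \<kappa> j) \<theta> n + coeff (e \<kappa> j) \<theta>bar n) = \<mu> * (1 - \<beta> * \<kappa>)\<^sup>2 * coeff (e \<kappa> j) \<theta>bar n"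
proof -
  \<comment> \<open>This makes the coefficient of \<open>G\<close> equal to \<open>d / k\<close>
    times the residual \<open>k * coeff f abar n - \<mu> * d * coeff f \<theta>bar n\<close> of the
    first-order condition. The members of \<open>G\<close> are admissible amplitudes, so the
    residual can be tested against exactly what \<open>coeff_eq_0\<close> requires.\<close>
  define c where "c = - \<mu> * d\<^sup>2 / k"
  define G where "G = (\<lambda>x t \<omega>. target x t \<omega> + c * \<theta>bar x t \<omega>)"
  have G: "G \<in> Ainf_space \<nu> M F T"
    unfolding G_def by (rule Ainf_space_add_scaled[OF target thetabar])
  have coeff_G: "AE n in N. coeff f G n = d * coeff f abar n + c * coeff f \<theta>bar n"
    using coeff_add_scaled[OF sf Ainf_spaceD(1)[OF target] Ainf_spaceD(1)[OF thetabar], of c]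
      coeff_equilibrium[OF equilibrium_abar Ainf_spaceD(1)[OF target] f]
    unfolding G_def d_def by eventually_elim simp
  have "AE n in N. coeff f G n = 0"
  proof (rule coeff_eq_0[OF sf Ainf_spaceD(1)[OF G]])
    fix x :: real assume x: "x \<in> {0..1}"
    note \<psi> = Ainf_spaceD(3,2)[OF G x]
    define g where "g = (\<lambda>n. case n of (t, \<omega>) \<Rightarrow> G x t \<omega>)"
    have g: "square_integrable N g" using \<psi>(2) by (simp add: g_def)
    note sq = square_integrable_coeff[OF sf Ainf_spaceD(1)[OF G]]
      square_integrable_coeff[OF sf Ainf_spaceD(1)[OF abar]]
      square_integrable_coeff[OF sf Ainf_spaceD(1)[OF thetabar]]
    note int = square_integrable_mult[OF sq(1) g] square_integrable_mult[OF sq(2) g]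
      square_integrable_mult[OF sq(3) g]
    have "(\<integral>n. coeff f G n * g n \<partial>N) =
        (\<integral>n. d * (coeff f abar n * g n) + c * (coeff f \<theta>bar n * g n) \<partial>N)"
    proof (rule integral_cong_AE)
      show "AE n in N. coeff f G n * g n = d * (coeff f abar n * g n) + c * (coeff f \<theta>bar n * g n)"
        using coeff_G by eventually_elim (simp add: algebra_simps)
    qed (use int in \<open>auto intro!: borel_measurable_integrable\<close>)
    also have "\<dots> = d * (\<integral>n. coeff f abar n * g n \<partial>N) + c * (\<integral>n. coeff f \<theta>bar n * g n \<partial>N)"
      using int by simp
    also have "\<dots> = d / k * (k * (\<integral>n. coeff f abar n * g n \<partial>N) - \<mu> * (d * (\<integral>n. coeff f \<theta>bar n * g n \<partial>N)))"
      using k by (simp add: c_def field_simps power2_eq_square)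
    also have "\<dots> = 0"
      using first_order_tested[OF \<psi>] by (simp add: g_def)
    finally show "(\<integral>n. coeff f G n * flat G (x, n) \<partial>N) = 0" by (simp add: g_def)
  qed
  with coeff_G coeff_target coeff_equilibrium[OF equilibrium_abar Ainf_spaceD(1)[OF target] f]
  have "AE n in N. coeff f \<theta> n + coeff f \<theta>bar n + c * coeff f \<theta>bar n = 0"
    by eventually_elim (simp add: d_def)
  then show ?thesis
    by eventually_elim (use k in \<open>simp add: c_def f_def d_def field_simps\<close>)
qed

text \<open>Otherwise stationarity would force the coefficient of \<theta> to vanish too. This
  guarantees a direction in which the reflection below is a genuine move.\<close>

lemma coeff_thetabar_nonzero: "\<not> (AE n in N. coeff (e \<kappa> j) \<theta>bar n = 0)"
proof
  assume "AE n in N. coeff (e \<kappa> j) \<theta>bar n = 0"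
  with first_order_coeff theta_coeff[OF i] have "AE n in N. False"
    by eventually_elim (use k in simp)
  with AE_N_False show False ..
qed

text \<open>
  Second-order condition: reflecting \<open>\<theta>bar\<close> in the hyperplane orthogonal to \<open>f \<otimes> \<psi>\<close> keeps its
  norm, hence feasibility, and changes the objective by a multiple of \<open>k - \<mu> d\<^sup>2\<close>.
\<close>
lemma multiplier_gt: "k < \<mu> * (1 - \<beta> * \<kappa>)\<^sup>2"
proof -
  \<comment> \<open>By \<open>coeff_eq_0\<close> a nonvanishing coefficient pairs nontrivially with
    some member of \<open>\<theta>bar\<close>, and that member becomes the amplitude.\<close>
  have "\<not> (\<forall>x\<in>{0..1}. (\<integral>n. coeff f \<theta>bar n * flat \<theta>bar (x, n) \<partial>N) = 0)"
    using coeff_eq_0[OF sf Ainf_spaceD(1)[OF thetabar]] coeff_thetabar_nonzero by (auto simp: f_def)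
  then obtain x :: real where x: "x \<in> {0..1}"
    and ne: "(\<integral>n. coeff f \<theta>bar n * flat \<theta>bar (x, n) \<partial>N) \<noteq> 0" by blast
  note \<psi> = Ainf_spaceD(3,2)[OF thetabar x]
  define g where "g = (\<lambda>n. case n of (t, \<omega>) \<Rightarrow> \<theta>bar x t \<omega>)"
  have g: "square_integrable N g" using \<psi>(2) by (simp add: g_def)
  define s where "s = (\<integral>n. coeff f \<theta>bar n * g n \<partial>N)"
  define p where "p = (\<integral>n. (g n)\<^sup>2 \<partial>N)"
  have s: "s \<noteq> 0" using ne by (simp add: s_def g_def)
  have "s\<^sup>2 \<le> (\<integral>n. (coeff f \<theta>bar n)\<^sup>2 \<partial>N) * p"
    unfolding s_def p_def
    by (rule integral_Cauchy_Schwarz[OF square_integrable_coeff[OF sf Ainf_spaceD(1)[OF thetabar]] g])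
  with s have "p \<noteq> 0" by auto
  then have p: "p > 0" by (simp add: p_def less_le)
  have norm_f: "(\<integral>x. (f x)\<^sup>2 \<partial>\<nu>) = 1"
    using spectral_index_orthonormal[OF basis i i] by (simp add: f_def power2_eq_square)
  have norm: "Ainf_norm_sq \<nu> M T (\<lambda>y t \<omega>. (c * f y) * \<theta>bar x t \<omega>) = c\<^sup>2 * p" for c
  proof -
    note sc = square_integrable_scaled[OF sf, of c]
    have t: "(\<lambda>y t \<omega>. (c * f y) * \<theta>bar x t \<omega>) \<in> Ainf_space \<nu> M F T"
      using Ainf_space_tensor[OF sc \<psi>] by simp
    have "Ainf_norm_sq \<nu> M T (\<lambda>y t \<omega>. (c * f y) * \<theta>bar x t \<omega>) =
      (\<integral>q. flat (\<lambda>y t \<omega>. (c * f y) * \<theta>bar x t \<omega>) q * ((c * f (fst q)) * g (snd q)) \<partial>X)"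
      unfolding Ainf_norm_sq_eq[OF t]
      by (intro Bochner_Integration.integral_cong refl)
        (simp add: case_prod_unfold g_def power2_eq_square)
    also have "\<dots> = (\<integral>y. (c * f y) * (\<integral>n. (c * f y) * (g n)\<^sup>2 \<partial>N) \<partial>\<nu>)"
      unfolding integral_mult_tensor(2)[OF sc Ainf_spaceD(1)[OF t] g]
      by (simp add: case_prod_unfold g_def power2_eq_square mult.assoc)
    also have "\<dots> = (\<integral>y. c\<^sup>2 * p * (f y)\<^sup>2 \<partial>\<nu>)"
      by (simp only: integral_mult_right_zero flip: p_def) (simp add: power2_eq_square ac_simps)
    finally show ?thesis by (simp add: norm_f)
  qed
  \<comment> \<open>The nonzero root of \<open>2 * \<epsilon> * (d * s) + \<epsilon>\<^sup>2 *
    (d\<^sup>2 * p) = 0\<close>, that is, the step of the reflection.\<close>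
  define \<epsilon> where "\<epsilon> = - 2 * s / (d * p)"
  note v = variation_tensor[OF f \<psi>, folded d_def]
  have ih: "inner \<theta>bar (\<lambda>y t \<omega>. (d * f y) * \<theta>bar x t \<omega>) = d * s"
    using inner_tensor[OF thetabar sf \<psi>(2), of d] by (simp add: s_def g_def)
  have "2 * \<epsilon> * (d * s) + \<epsilon>\<^sup>2 * (d\<^sup>2 * p) = 0"
    using p d by (simp add: \<epsilon>_def field_simps power2_eq_square)
  then have "Ainf_norm_sq \<nu> M T \<theta>bar + 2 * \<epsilon> * inner \<theta>bar (\<lambda>y t \<omega>. (d * f y) * \<theta>bar x t \<omega>)
      + \<epsilon>\<^sup>2 * Ainf_norm_sq \<nu> M T (\<lambda>y t \<omega>. (d * f y) * \<theta>bar x t \<omega>) \<le> C"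
    unfolding ih norm using norm_thetabar by simp
  from variation_quadratic[OF v this]
  have "2 * \<epsilon> * (\<mu> * (d * s)) + \<epsilon>\<^sup>2 * (k * p) \<le> 0"
    using \<mu>[OF v] ih norm[of 1] by simp
  also have "2 * \<epsilon> * (\<mu> * (d * s)) + \<epsilon>\<^sup>2 * (k * p) = 4 * s\<^sup>2 / (d\<^sup>2 * p) * (k - \<mu> * d\<^sup>2)"
    using p d by (simp add: \<epsilon>_def field_simps power2_eq_square)
  finally have "k - \<mu> * d\<^sup>2 \<le> 0"
    using p d s by (simp add: mult_le_0_iff divide_le_0_iff)
  \<comment> \<open>The reflection yields only a weak inequality. Under equality the
    \<open>\<theta>bar\<close> terms of the stationarity condition cancel, leaving a vanishing
    coefficient of \<theta>.\<close>
  moreover have "k \<noteq> \<mu> * d\<^sup>2"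
  proof
    assume eq: "k = \<mu> * d\<^sup>2"
    from first_order_coeff theta_coeff[OF i] have "AE n in N. False"
    proof eventually_elim
      case (elim n)
      then have "k * coeff (e \<kappa> j) \<theta> n = 0"
        unfolding d_def[symmetric] eq[symmetric] by (simp add: distrib_left)
      with elim(2) k show ?case by simp
    qed
    with AE_N_False show False ..
  qed
  ultimately show ?thesis by (simp add: d_def)
qed

lemma coeff_thetabar:
  "AE n in N. coeff (e \<kappa> j) \<theta>bar n = k / (\<mu> * (1 - \<beta> * \<kappa>)\<^sup>2 - k) * coeff (e \<kappa> j) \<theta> n"
  using first_order_coeff
  by eventually_elim (use multiplier_gt in \<open>simp add: field_simps\<close>)

end

text \<open>A zero multiplier, tested with \<open>target\<close> itself, gives
  \<open>abar = 0\<close> and hence \<open>\<theta>bar = - \<theta>\<close> almost everywhere, which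
  exceeds the budget by \<open>large\<close>.\<close>

lemma multiplier_nonzero:
  assumes \<mu>: "\<And>h b. variation h b \<Longrightarrow> k * inner abar b = \<mu> * inner \<theta>bar h" and neg: "k < 0"
  shows "\<mu> \<noteq> 0"
proof
  assume "\<mu> = 0"
  with \<mu>[OF variation_target] k inner_self[OF abar] have "Ainf_norm_sq \<nu> M T abar = 0" by simp
  then have a0: "AE p in X. flat abar p = 0"
    using AE_eq_0_if_integral_power2_eq_0[OF Ainf_spaceD(1)[OF abar]] Ainf_norm_sq_eq[OF abar] by simp
  \<comment> \<open>The operator integrates over a whole section, so the null set is first passed to
    sections.\<close>
  have "AE n in N. \<forall>x\<in>{0..1}. case (x, n) of (x, t, \<omega>) \<Rightarrow> graphon_op_process \<nu> W abar x t \<omega> = 0"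
    using AE_X_snd[OF a0]
  proof eventually_elim
    case (elim n)
    have "AE y in \<nu>. W x y * flat abar (y, n) = 0" for x
      using elim by eventually_elim simp
    from integral_eq_zero_AE[OF this] show ?case
      by (auto simp: graphon_op_process_def graphon_op_def)
  qed
  from AE_X_sndI[OF this] a0 equilibriumD(3)[OF equilibrium_abar]
  have "AE p in X. (flat \<theta> p)\<^sup>2 = (flat \<theta>bar p)\<^sup>2"
    by eventually_elim (auto simp: target_def power2_eq_iff)
  then have "(\<integral>p. (flat \<theta> p)\<^sup>2 \<partial>X) = (\<integral>p. (flat \<theta>bar p)\<^sup>2 \<partial>X)"
    using square_integrable_power2[OF Ainf_spaceD(1)[OF theta]]
      square_integrable_power2[OF Ainf_spaceD(1)[OF thetabar]]
    by (intro integral_cong_AE) (auto intro: borel_measurable_integrable)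
  with large[OF neg] norm_thetabar show False
    by (simp add: Ainf_norm_sq_eq[OF theta] Ainf_norm_sq_eq[OF thetabar])
qed

text \<open>Positivity of \<mu> is asserted for each index because for \<open>k > 0\<close> it is
  read off from the strict inequality at that index.\<close>

lemma optimal_coefficients:
  obtains \<mu> where "\<And>\<kappa> j. (\<kappa>, j) \<in> spectral_index W \<Longrightarrow> \<mu> > 0 \<and> k < \<mu> * (1 - \<beta> * \<kappa>)\<^sup>2"
    and "AE n in N. \<forall>(\<kappa>, j)\<in>spectral_index W. coeff (e \<kappa> j) \<theta> n \<noteq> 0 \<and>
      coeff (e \<kappa> j) \<theta>bar n = k / (\<mu> * (1 - \<beta> * \<kappa>)\<^sup>2 - k) * coeff (e \<kappa> j) \<theta> n"
proof -
  obtain \<mu> where \<mu>: "\<mu> \<ge> 0" "\<And>h b. variation h b \<Longrightarrow> k * inner abar b = \<mu> * inner \<theta>bar h"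
    by (rule lagrange_multiplier) blast
  show ?thesis
  proof
    fix \<kappa> j assume i: "(\<kappa>, j) \<in> spectral_index W"
    have gt: "k < \<mu> * (1 - \<beta> * \<kappa>)\<^sup>2" using \<mu>(2) i by (rule multiplier_gt)
    have "\<mu> \<noteq> 0"
      using gt multiplier_nonzero[OF \<mu>(2)] by (cases "k < 0") auto
    with \<mu>(1) gt show "\<mu> > 0 \<and> k < \<mu> * (1 - \<beta> * \<kappa>)\<^sup>2" by simp
  next
    show "AE n in N. \<forall>(\<kappa>, j)\<in>spectral_index W. coeff (e \<kappa> j) \<theta> n \<noteq> 0 \<and>
      coeff (e \<kappa> j) \<theta>bar n = k / (\<mu> * (1 - \<beta> * \<kappa>)\<^sup>2 - k) * coeff (e \<kappa> j) \<theta> n"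
    proof -
      have bar: "AE n in N. coeff (e \<kappa> j) \<theta>bar n = k / (\<mu> * (1 - \<beta> * \<kappa>)\<^sup>2 - k) * coeff (e \<kappa> j) \<theta> n"
        if "(\<kappa>, j) \<in> spectral_index W" for \<kappa> j
        using \<mu>(2) that by (rule coeff_thetabar)
      show ?thesis
      proof (subst AE_ball_countable[OF countable_spectral_index[OF basis]], safe)
        fix \<kappa> j assume i: "(\<kappa>, j) \<in> spectral_index W"
        show "AE n in N. coeff (e \<kappa> j) \<theta> n \<noteq> 0 \<and>
            coeff (e \<kappa> j) \<theta>bar n = k / (\<mu> * (1 - \<beta> * \<kappa>)\<^sup>2 - k) * coeff (e \<kappa> j) \<theta> n"
          using theta_coeff[OF i] bar[OF i] by eventually_elim simp
      qed
    qed
  qed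
qed

text \<open>The factor \<open>r\<close> is the quotient of the norms of the sections of \<theta> and
  \<open>\<theta>bar\<close>. It is positive because a nonzero coefficient forces a nonzero
  norm.\<close>

lemma similarity_ratio_eq:
  obtains \<mu> where "\<And>\<kappa> j. (\<kappa>, j) \<in> spectral_index W \<Longrightarrow> \<mu> > 0 \<and> k < \<mu> * (1 - \<beta> * \<kappa>)\<^sup>2"
    and "AE (t, \<omega>) in N. \<exists>r>0. \<forall>(\<kappa>, j)\<in>spectral_index W.
      similarity_ratio \<nu> e \<theta>bar \<theta> \<kappa> j t \<omega> = r * (k / (\<mu> * (1 - \<beta> * \<kappa>)\<^sup>2 - k))"
proof -
  obtain \<mu> where \<mu>: "\<And>\<kappa> j. (\<kappa>, j) \<in> spectral_index W \<Longrightarrow> \<mu> > 0 \<and> k < \<mu> * (1 - \<beta> * \<kappa>)\<^sup>2"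
    and ae: "AE n in N. \<forall>(\<kappa>, j)\<in>spectral_index W. coeff (e \<kappa> j) \<theta> n \<noteq> 0 \<and>
      coeff (e \<kappa> j) \<theta>bar n = k / (\<mu> * (1 - \<beta> * \<kappa>)\<^sup>2 - k) * coeff (e \<kappa> j) \<theta> n"
    by (rule optimal_coefficients) blast
  have norm_pos: "0 < L2_norm \<nu> g"
    if "square_integrable \<nu> g" "(\<kappa>, j) \<in> spectral_index W" "(\<integral>x. g x * e \<kappa> j x \<partial>\<nu>) \<noteq> 0" for g \<kappa> j
  proof -
    have "(\<integral>x. g x * e \<kappa> j x \<partial>\<nu>)\<^sup>2 \<le> (\<integral>x. (g x)\<^sup>2 \<partial>\<nu>) * (\<integral>x. (e \<kappa> j x)\<^sup>2 \<partial>\<nu>)"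
      using spectral_index_eigen[OF basis that(2)]
      by (intro integral_Cauchy_Schwarz that eigenspace_square_integrable)
    with that(3) have "(\<integral>x. (g x)\<^sup>2 \<partial>\<nu>) \<noteq> 0" by auto
    then show ?thesis by (simp add: L2_norm_def L2_inner_def less_le flip: power2_eq_square)
  qed
  have norm_e: "L2_norm \<nu> (e \<kappa> j) = 1" if "(\<kappa>, j) \<in> spectral_index W" for \<kappa> j
    using spectral_index_orthonormal[OF basis that that] by (simp add: L2_norm_def L2_inner_def)
  have "AE n in N. case n of (t, \<omega>) \<Rightarrow> \<exists>r>0. \<forall>(\<kappa>, j)\<in>spectral_index W.
      similarity_ratio \<nu> e \<theta>bar \<theta> \<kappa> j t \<omega> = r * (k / (\<mu> * (1 - \<beta> * \<kappa>)\<^sup>2 - k))"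
    using ae square_integrable_sections(2)[OF Ainf_spaceD(1)[OF theta]]
      square_integrable_sections(2)[OF Ainf_spaceD(1)[OF thetabar]]
  proof eventually_elim
    case (elim n)
    obtain t \<omega> where n: "n = (t, \<omega>)" by (cases n)
    define g where "g = (\<lambda>x. \<theta> x t \<omega>)"
    define gb where "gb = (\<lambda>x. \<theta>bar x t \<omega>)"
    have g: "square_integrable \<nu> g" "square_integrable \<nu> gb"
      using elim(2,3) by (simp_all add: g_def gb_def n)
    show ?case
    \<comment> \<open>Without any index no coefficient forces the norms to be positive, but then any
      \<open>r\<close> will do.\<close>
    proof (cases "spectral_index W = {}")
      case True
      then show ?thesis by (auto simp: n intro: exI[of _ 1])
    next
      case False
      have u: "(\<integral>x. g x * e \<kappa> j x \<partial>\<nu>) \<noteq> 0"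
        and v: "(\<integral>x. gb x * e \<kappa> j x \<partial>\<nu>) = k / (\<mu> * (1 - \<beta> * \<kappa>)\<^sup>2 - k) * (\<integral>x. g x * e \<kappa> j x \<partial>\<nu>)"
        if "(\<kappa>, j) \<in> spectral_index W" for \<kappa> j
        using elim(1) that by (auto simp: coeff_def n g_def gb_def)
      obtain \<kappa>0 j0 where i0: "(\<kappa>0, j0) \<in> spectral_index W" using False by auto
      have pos: "0 < L2_norm \<nu> g" "0 < L2_norm \<nu> gb"
        using norm_pos[OF g(1) i0 u[OF i0]] norm_pos[OF g(2) i0] u[OF i0] v[OF i0] k \<mu>[OF i0] by auto
      have "similarity_ratio \<nu> e \<theta>bar \<theta> \<kappa> j t \<omega> =
          L2_norm \<nu> g / L2_norm \<nu> gb * (k / (\<mu> * (1 - \<beta> * \<kappa>)\<^sup>2 - k))"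
        if "(\<kappa>, j) \<in> spectral_index W" for \<kappa> j
        using u[OF that] v[OF that] norm_e[OF that] pos
        by (simp add: similarity_ratio_def cosine_similarity_def L2_inner_def flip: g_def gb_def)
          (simp add: mult.commute)
      with pos show ?thesis
        by (auto simp: n intro!: exI[of _ "L2_norm \<nu> g / L2_norm \<nu> gb"])
    qed
  qed
  with \<mu> show ?thesis by (rule that)
qed

end

section \<open>Monotonicity of the similarity ratio\<close>

theorem corollary4p13:
  fixes T \<beta> C\<^sub>B w :: real
    and M :: "'w measure" and \<nu> :: "real measure" and Q :: "(real \<times> 'w) measure"
    and F :: "real \<Rightarrow> 'w measure"
    and W :: "real \<Rightarrow> real \<Rightarrow> real"
    and P :: "'w process \<Rightarrow> 'w process \<Rightarrow> real"
    and \<theta> \<theta>bar :: "real \<Rightarrow> 'w process"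
    and e :: "real \<Rightarrow> nat \<Rightarrow> real \<Rightarrow> real"
  assumes T: "T > 0"
    and M: "prob_space M"
    and nu: "extends_Lebesgue \<nu>"
    and Q: "rich_Fubini_extension \<nu> M Q"
    and F: "F = augmented_filtration M \<theta>"
    and W: "graphon W"
    and C_B: "C\<^sub>B > 0"
    and theta: "\<theta> \<in> Ainf_space \<nu> M F T"
    and basis: "orthonormal_eigenbasis W e"
    and B1: "\<beta> * largest_eigenvalue W < 1"
    and subst: "\<beta> < 0 \<Longrightarrow> \<forall>\<kappa>\<in>graphon_spectrum W. \<beta> * \<kappa> < 1"
    and B2_P: "external_effect_condition \<nu> M F T \<beta> W P w"
    and B2_w: "(w < -1/2 \<and> Ainf_norm_sq \<nu> M T \<theta> > C\<^sub>B) \<or> w > -1/2"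
    and B2_theta: "\<forall>(\<kappa>, j)\<in>spectral_index W.
          AE (t, \<omega>) in time_measure T \<Otimes>\<^sub>M M. spectral_coeff \<nu> e \<theta> \<kappa> j t \<omega> \<noteq> 0"
    and opt: "optimal_intervention \<nu> M F T \<beta> W C\<^sub>B P \<theta> \<theta>bar"
  shows "(\<beta> > 0 \<longrightarrow>
            (AE (t, \<omega>) in time_measure T \<Otimes>\<^sub>M M.
               \<forall>(\<kappa>, j)\<in>spectral_index W. \<forall>(\<kappa>', j')\<in>spectral_index W. \<kappa> < \<kappa>' \<longrightarrow>
                 \<bar>similarity_ratio \<nu> e \<theta>bar \<theta> \<kappa> j t \<omega>\<bar> < \<bar>similarity_ratio \<nu> e \<theta>bar \<theta> \<kappa>' j' t \<omega>\<bar>))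
       \<and> (\<beta> < 0 \<longrightarrow>
            (AE (t, \<omega>) in time_measure T \<Otimes>\<^sub>M M.
               \<forall>(\<kappa>, j)\<in>spectral_index W. \<forall>(\<kappa>', j')\<in>spectral_index W. \<kappa> < \<kappa>' \<longrightarrow>
                 \<bar>similarity_ratio \<nu> e \<theta>bar \<theta> \<kappa> j t \<omega>\<bar> > \<bar>similarity_ratio \<nu> e \<theta>bar \<theta> \<kappa>' j' t \<omega>\<bar>))"
proof (cases "\<beta> = 0")
  case True
  then show ?thesis by simp
next
  case False
  interpret prob_space M by (rule M)
  interpret graphon_setting M \<nu> T W by unfold_locales (rule nu, rule W)
  define k where "k = 1/2 + w"
  obtain abar zbar where feas: "feasible \<nu> M F T \<beta> W C\<^sub>B \<theta> \<theta>bar abar zbar"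
    and max: "\<And>h a z. feasible \<nu> M F T \<beta> W C\<^sub>B \<theta> h a z \<Longrightarrow>
      welfare \<nu> M T \<beta> P \<theta> h a z \<le> welfare \<nu> M T \<beta> P \<theta> \<theta>bar abar zbar"
    using opt by (auto simp: optimal_intervention_def)
  \<comment> \<open>For \<open>\<beta> < 0\<close> multiplication reverses the order, so the largest
    eigenvalue gives no upper bound on \<open>\<beta> * \<kappa>\<close>; there \<open>subst\<close>
    supplies it.\<close>
  have gap: "\<beta> * \<kappa> < 1" if "(\<kappa>, j) \<in> spectral_index W" for \<kappa> j
  proof (cases "\<beta> < 0")
    case True
    with subst that show ?thesis by (auto simp: spectral_index_def)
  next
    case False
    then have "\<beta> * \<kappa> \<le> \<beta> * largest_eigenvalue W"
      using spectral_index_le_largest_eigenvalue[OF basis that] by (intro mult_left_mono) auto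
    with B1 show ?thesis by simp
  qed
  interpret intervention M \<nu> T W F \<beta> "C\<^sub>B" k e \<theta> \<theta>bar abar zbar
  proof unfold_locales
    show "k \<noteq> 0" using B2_w by (auto simp: k_def)
    show "C\<^sub>B < Ainf_norm_sq \<nu> M T \<theta>" if "k < 0" using that B2_w by (auto simp: k_def)
    show "AE n in N. coeff (e \<kappa> j) \<theta> n \<noteq> 0" if "(\<kappa>, j) \<in> spectral_index W" for \<kappa> j
      using B2_theta that by (auto simp: spectral_coeff_def L2_inner_def coeff_def case_prod_unfold)
    show "k * Ainf_norm_sq \<nu> M T a \<le> k * Ainf_norm_sq \<nu> M T abar"
      if "feasible \<nu> M F T \<beta> W C\<^sub>B \<theta> h a z" for h a z
      using max[OF that] welfare_eq[OF B2_P theta that] welfare_eq[OF B2_P theta feas]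
      by (simp add: k_def)
  qed (fact T C_B basis gap theta feas)+
  obtain \<mu> where \<mu>: "\<And>\<kappa> j. (\<kappa>, j) \<in> spectral_index W \<Longrightarrow> \<mu> > 0 \<and> k < \<mu> * (1 - \<beta> * \<kappa>)\<^sup>2"
    and ratio: "AE (t, \<omega>) in N. \<exists>r>0. \<forall>(\<kappa>, j)\<in>spectral_index W.
      similarity_ratio \<nu> e \<theta>bar \<theta> \<kappa> j t \<omega> = r * (k / (\<mu> * (1 - \<beta> * \<kappa>)\<^sup>2 - k))"
    by (rule similarity_ratio_eq) blast
  \<comment> \<open>Squaring preserves the order because \<open>gap\<close> makes both bases
    positive. Strictness then survives because \<mu>, \<open>r\<close> and the absolute value of
    \<open>k\<close> are positive.\<close>
  have mono: "\<bar>r * (k / (\<mu> * (1 - \<beta> * \<kappa>)\<^sup>2 - k))\<bar> < \<bar>r * (k / (\<mu> * (1 - \<beta> * \<kappa>')\<^sup>2 - k))\<bar>"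
    if i: "(\<kappa>, j) \<in> spectral_index W" "(\<kappa>', j') \<in> spectral_index W"
      and lt: "\<beta> * \<kappa> < \<beta> * \<kappa>'" and r: "r > 0" for r \<kappa> j \<kappa>' j'
  proof -
    have "(1 - \<beta> * \<kappa>')\<^sup>2 < (1 - \<beta> * \<kappa>)\<^sup>2"
      using gap[OF i(2)] lt by (intro power_strict_mono) auto
    then have "\<mu> * (1 - \<beta> * \<kappa>')\<^sup>2 - k < \<mu> * (1 - \<beta> * \<kappa>)\<^sup>2 - k"
      using \<mu>[OF i(1)] by simp
    moreover have "0 < \<mu> * (1 - \<beta> * \<kappa>')\<^sup>2 - k"
      using \<mu>[OF i(2)] by simp
    moreover have "0 < \<bar>k\<bar>" using B2_w by (auto simp: k_def)
    ultimately have "r * \<bar>k\<bar> / (\<mu> * (1 - \<beta> * \<kappa>)\<^sup>2 - k) < r * \<bar>k\<bar> / (\<mu> * (1 - \<beta> * \<kappa>')\<^sup>2 - k)"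
      using r by (intro divide_strict_left_mono mult_pos_pos) auto
    then show ?thesis using r \<mu>[OF i(1)] \<mu>[OF i(2)] by (simp add: abs_mult)
  qed
  show ?thesis
  proof (intro conjI impI)
    assume "\<beta> > 0"
    from ratio show "AE (t, \<omega>) in N. \<forall>(\<kappa>, j)\<in>spectral_index W. \<forall>(\<kappa>', j')\<in>spectral_index W. \<kappa> < \<kappa>' \<longrightarrow>
        \<bar>similarity_ratio \<nu> e \<theta>bar \<theta> \<kappa> j t \<omega>\<bar> < \<bar>similarity_ratio \<nu> e \<theta>bar \<theta> \<kappa>' j' t \<omega>\<bar>"
    proof eventually_elim
      case (elim n)
      obtain t \<omega> where n: "n = (t, \<omega>)" by (cases n)
      with elim obtain r where "r > 0" and r: "\<And>\<kappa> j. (\<kappa>, j) \<in> spectral_index W \<Longrightarrow>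
          similarity_ratio \<nu> e \<theta>bar \<theta> \<kappa> j t \<omega> = r * (k / (\<mu> * (1 - \<beta> * \<kappa>)\<^sup>2 - k))"
        by auto
      have "\<bar>similarity_ratio \<nu> e \<theta>bar \<theta> \<kappa> j t \<omega>\<bar> < \<bar>similarity_ratio \<nu> e \<theta>bar \<theta> \<kappa>' j' t \<omega>\<bar>"
        if i: "(\<kappa>, j) \<in> spectral_index W" "(\<kappa>', j') \<in> spectral_index W" and "\<kappa> < \<kappa>'" for \<kappa> j \<kappa>' j'
        unfolding r[OF i(1)] r[OF i(2)] 
        using \<open>\<beta> > 0\<close> \<open>\<kappa> < \<kappa>'\<close> \<open>r > 0\<close>
        by (intro mono[OF i] mult_strict_left_mono)
      then show ?case by (auto simp: n)
    qed
  next
    assume "\<beta> < 0"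
    from ratio show "AE (t, \<omega>) in N. \<forall>(\<kappa>, j)\<in>spectral_index W. \<forall>(\<kappa>', j')\<in>spectral_index W. \<kappa> < \<kappa>' \<longrightarrow>
        \<bar>similarity_ratio \<nu> e \<theta>bar \<theta> \<kappa> j t \<omega>\<bar> > \<bar>similarity_ratio \<nu> e \<theta>bar \<theta> \<kappa>' j' t \<omega>\<bar>"
    proof eventually_elim
      case (elim n)
      obtain t \<omega> where n: "n = (t, \<omega>)" by (cases n)
      with elim obtain r where "r > 0" and r: "\<And>\<kappa> j. (\<kappa>, j) \<in> spectral_index W \<Longrightarrow>
          similarity_ratio \<nu> e \<theta>bar \<theta> \<kappa> j t \<omega> = r * (k / (\<mu> * (1 - \<beta> * \<kappa>)\<^sup>2 - k))"
        by auto
      have "\<bar>similarity_ratio \<nu> e \<theta>bar \<theta> \<kappa> j t \<omega>\<bar> > \<bar>similarity_ratio \<nu> e \<theta>bar \<theta> \<kappa>' j' t \<omega>\<bar>"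
        if i: "(\<kappa>, j) \<in> spectral_index W" "(\<kappa>', j') \<in> spectral_index W" and "\<kappa> < \<kappa>'" for \<kappa> j \<kappa>' j'
        unfolding r[OF i(1)] r[OF i(2)] 
        using \<open>\<beta> < 0\<close> \<open>\<kappa> < \<kappa>'\<close> \<open>r > 0\<close>
        by (intro mono[OF i(2) i(1)] mult_strict_left_mono_neg)
      then show ?case by (auto simp: n)
    qed
  qed
qed

end
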